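(* Let $s\in(1,2]$ and let $\alpha$ be a cardinal number. Then the set $\overline{B}_s[0,1]=\{f\in C[0,1]:\overline{\dim}_B G_f([0,1])=s\}$ is $(\alpha,\mathfrak{c})$-spaceable if and only if $\alpha<\aleph_0$.
   Context: $C[0,1]$ is the real Banach space of real-valued continuous functions on $[0,1]$ with the maximum norm. $G_f(X)=\{(x,f(x)):x\in X\}$ is the graph of $f$ over $X$, and $\overline{\dim}_B$ denotes upper box dimension. $\mathfrak{c}$ is the cardinality of $\mathbb{R}$, $\aleph_0$ that of $\mathbb{N}$. For cardinals $\alpha<\beta$, a subset $A$ of a topological vector space is $\alpha$-lineable if there is an $\alpha$-dimensional linear subspace $M\subseteq A\cup\{0\}$; it is $(\alpha,\beta)$-spaceable if it is $\alpha$-lineable and for every $\alpha$-dimensional subspace $W_\alpha\subseteq A\cup\{0\}$ there is a closed $\beta$-dimensional subspace $W_\beta$ with $W_\alpha\subseteq W_\beta\subseteq A\cup\{0\}$. *)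

theory Defs
  imports "HOL-Analysis.Analysis" "HOL-Library.Equipollence"
begin

text \<open>C[0,1] is represented isometrically inside the Banach space of bounded
continuous functions real to real (sup norm): f in C[0,1] corresponds to the
function x \<mapsto> f (max 0 (min 1 x)). This is a closed linear subspace, and the
sup norm of such a function equals the maximum norm of f on [0,1].\<close>

definition C01 :: "(real \<Rightarrow>\<^sub>C real) set" where
  "C01 = {f. \<forall>x. apply_bcontfun f x = apply_bcontfun f (max 0 (min 1 x))}"

definition graph01 :: "(real \<Rightarrow>\<^sub>C real) \<Rightarrow> (real \<times> real) set" where
  "graph01 f = {(x, apply_bcontfun f x) | x. x \<in> {0..1}}"

definition covering_number :: "real \<Rightarrow> ('a::metric_space) set \<Rightarrow> nat" where
  "covering_number \<delta> F = (LEAST n. \<exists>C. finite C \<and> card C \<le> n \<and> F \<subseteq> \<Union>C \<and>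
      (\<forall>U\<in>C. bounded U \<and> diameter U \<le> \<delta>))"

definition upper_box_dim :: "('a::metric_space) set \<Rightarrow> ereal" where
  "upper_box_dim F = Limsup (at_right 0)
      (\<lambda>\<delta>. ereal (ln (real (covering_number \<delta> F)) / (- ln \<delta>)))"

definition upper_box_set :: "real \<Rightarrow> (real \<Rightarrow>\<^sub>C real) set" where
  "upper_box_set s = {f \<in> C01. upper_box_dim (graph01 f) = ereal s}"

definition has_dim :: "('v::real_vector) set \<Rightarrow> 'x set \<Rightarrow> bool" where
  "has_dim M X \<longleftrightarrow> (\<exists>B. independent B \<and> span B = M \<and> B \<approx> X)"

definition lineable :: "'x set \<Rightarrow> ('v::real_vector) set \<Rightarrow> bool" where
  "lineable X A \<longleftrightarrow> (\<exists>M. subspace M \<and> M \<subseteq> A \<union> {0} \<and> has_dim M X)"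

text \<open>(alpha,beta)-spaceable, defined for cardinals alpha < beta (so alpha < beta is part of it).\<close>
definition spaceable :: "'x set \<Rightarrow> 'y set \<Rightarrow> ('v::real_normed_vector) set \<Rightarrow> bool" where
  "spaceable X Y A \<longleftrightarrow> X \<prec> Y \<and> lineable X A \<and>
     (\<forall>W. subspace W \<and> W \<subseteq> A \<union> {0} \<and> has_dim W X \<longrightarrow>
        (\<exists>W'. subspace W' \<and> closed W' \<and> has_dim W' Y \<and> W \<subseteq> W' \<and> W' \<subseteq> A \<union> {0}))"

end

theory Submission
  imports Defs "HOL-Real_Asymp.Real_Asymp" "HOL-Computational_Algebra.Polynomial"
begin

text \<open>The upper box dimension of the graph of a continuous f is at most t (for t at least 1) iff the sum of
  the oscillations of f over the columns of width \<delta> grows at most like \<delta>^(1-t-\<epsilon>). Oscillation sums are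
  subadditive, so the functions with dimension at most s and those with dimension less than s form
  subspaces L and N, and the set in question is L - N.

  For infinite \<alpha>, an unbounded linear functional on a space contained in L - N produces another such
  space, of the same dimension, whose closure contains the identity, which lies in N. For finite \<alpha>, a
  finite-dimensional space W with W - 0 in L - N keeps this property when its functions are only looked
  at outside a suitable dyadic interval. Inside that interval one adds the closed space V of functions that
  on each of infinitely many dyadic blocks are a multiple of a rescaled Takagi-type function, which is
  Hoelder continuous with exponent 2 - s and has oscillation sums of the maximal order; all nonzero
  elements of V have dimension s.\<close>

section \<open>Oscillation sums\<close>

text \<open>Box dimension is not continuous under uniform limits, so closedness and membership must
  be built into the construction. Covering numbers of graphs have no useful subadditivity, while
  oscillations do; hence the translation. W and V are kept apart by location. Clipping to the
  complement of a dyadic interval is linear, preserves N and annihilates V up to nothing at all, so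
  if w + v lies in N, then first w and then v must vanish. Clipping creates additive constants,
  which are harmless because N contains them. The blocks of V need no decay condition on their
  scalars. At scale \<delta> only about log (1 / \<delta>) blocks are longer than \<delta>, a factor
  absorbed by the \<epsilon> in the exponent. Conversely, one nonzero block already forces the
  exponent s, since an eventual bound is refuted along \<delta> = 2^-m. In the other direction,
  aleph_0 enters because a linear functional can be unbounded only on an infinite-dimensional
  space.\<close>

lemma card_grid_le:
  fixes a b \<delta> :: real
  assumes "a \<le> b" "0 < \<delta>"
  shows "finite {i::nat. a \<le> (real i + 1) * \<delta> \<and> real i * \<delta> \<le> b}" (is "finite ?S")
    and "real (card {i::nat. a \<le> (real i + 1) * \<delta> \<and> real i * \<delta> \<le> b}) \<le> (b - a) / \<delta> + 2"
proof -
  let ?T = "{\<lceil>a / \<delta> - 1\<rceil>..\<lfloor>b / \<delta>\<rfloor>}"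
  have sub: "int ` ?S \<subseteq> ?T"
    using assms by (auto simp: ceiling_le_iff le_floor_iff field_simps)
  have inj: "inj_on int ?S" by simp
  show "finite ?S"
    using finite_imageD[OF finite_subset[OF sub] inj] by simp
  have "card ?S = card (int ` ?S)" by (simp add: card_image)
  also have "\<dots> \<le> card ?T" by (intro card_mono sub) simp
  \<comment> \<open>The conversion \<open>nat\<close> cuts negative lengths off at 0, hence the
    maximum in the next line; a \<le> b then makes its second argument positive.\<close>
  finally have "real (card ?S) \<le> real (nat (\<lfloor>b / \<delta>\<rfloor> - \<lceil>a / \<delta> - 1\<rceil> + 1))" by simp
  also have "\<dots> \<le> max 0 (b / \<delta> - (a / \<delta> - 1) + 1)"
    by linarith
  also have "\<dots> = (b - a) / \<delta> + 2"
    using assms by (simp add: field_simps max_def)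
  finally show "real (card ?S) \<le> (b - a) / \<delta> + 2" .
qed

definition osc :: "(real \<Rightarrow> real) \<Rightarrow> real \<Rightarrow> nat \<Rightarrow> real" where
  "osc f \<delta> i = diameter (f ` {real i * \<delta>..(real i + 1) * \<delta>})"

text \<open>The last index is included so that the columns cover [0, 1] even if \<delta> does not
  divide 1. The last column may reach beyond 1, where functions from \<open>C01\<close> are
  constant.\<close>

definition osc_sum :: "(real \<Rightarrow> real) \<Rightarrow> real \<Rightarrow> real" where
  "osc_sum f \<delta> = (\<Sum>i\<le>nat \<lfloor>1 / \<delta>\<rfloor>. osc f \<delta> i)"

abbreviation clip :: "real \<Rightarrow> real \<Rightarrow> real \<Rightarrow> real" where
  "clip a b x \<equiv> max a (min b x)"

lemma abs_diff_le_osc: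
  assumes "continuous_on UNIV f" "x \<in> {real i * \<delta>..(real i + 1) * \<delta>}"
    "y \<in> {real i * \<delta>..(real i + 1) * \<delta>}"
  shows "\<bar>f x - f y\<bar> \<le> osc f \<delta> i"
proof -
  have "bounded (f ` {real i * \<delta>..(real i + 1) * \<delta>})"
    using assms(1) by (intro compact_imp_bounded compact_continuous_image)
      (auto intro: continuous_on_subset)
  from diameter_bounded_bound[OF this, of "f x" "f y"] assms show ?thesis
    by (auto simp: osc_def dist_real_def)
qed

lemma osc_le:
  assumes "0 \<le> H" "\<And>x y. x \<in> {real i * \<delta>..(real i + 1) * \<delta>} \<Longrightarrow>
    y \<in> {real i * \<delta>..(real i + 1) * \<delta>} \<Longrightarrow> \<bar>f x - f y\<bar> \<le> H"
  shows "osc f \<delta> i \<le> H"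
  unfolding osc_def using assms by (intro diameter_le) auto

lemma osc_nonneg:
  assumes "continuous_on UNIV f" "0 < \<delta>"
  shows "0 \<le> osc f \<delta> i"
proof -
  have "\<bar>f (real i * \<delta>) - f (real i * \<delta>)\<bar> \<le> osc f \<delta> i"
    using assms by (intro abs_diff_le_osc) (auto simp: algebra_simps)
  then show ?thesis by simp
qed

lemma osc_add_le:
  assumes "continuous_on UNIV f" "continuous_on UNIV g" "0 < \<delta>"
  shows "osc (\<lambda>x. f x + g x) \<delta> i \<le> osc f \<delta> i + osc g \<delta> i"
proof (rule osc_le)
  show "0 \<le> osc f \<delta> i + osc g \<delta> i" using osc_nonneg assms by (simp add: add_nonneg_nonneg)
  fix x y assume xy: "x \<in> {real i * \<delta>..(real i + 1) * \<delta>}" "y \<in> {real i * \<delta>..(real i + 1) * \<delta>}"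
  show "\<bar>f x + g x - (f y + g y)\<bar> \<le> osc f \<delta> i + osc g \<delta> i"
    using abs_diff_le_osc[OF assms(1) xy] abs_diff_le_osc[OF assms(2) xy] by linarith
qed

lemma osc_scale_le:
  assumes "continuous_on UNIV f" "0 < \<delta>"
  shows "osc (\<lambda>x. c * f x) \<delta> i \<le> \<bar>c\<bar> * osc f \<delta> i"
proof (rule osc_le)
  show "0 \<le> \<bar>c\<bar> * osc f \<delta> i" using osc_nonneg assms by simp
  fix x y assume xy: "x \<in> {real i * \<delta>..(real i + 1) * \<delta>}" "y \<in> {real i * \<delta>..(real i + 1) * \<delta>}"
  have "\<bar>c * f x - c * f y\<bar> = \<bar>c\<bar> * \<bar>f x - f y\<bar>" by (simp add: abs_mult flip: right_diff_distrib)
  also have "\<dots> \<le> \<bar>c\<bar> * osc f \<delta> i" by (intro mult_left_mono abs_diff_le_osc assms xy) auto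
  finally show "\<bar>c * f x - c * f y\<bar> \<le> \<bar>c\<bar> * osc f \<delta> i" .
qed

text \<open>The clip maps a column that meets [a, b] into itself and a column that misses [a, b] to
  a single point.\<close>

lemma osc_clamp_le:
  assumes "continuous_on UNIV f" "0 < \<delta>" "a \<le> b"
  shows "osc (\<lambda>x. f (clip a b x)) \<delta> i \<le> osc f \<delta> i"
proof (rule osc_le)
  show "0 \<le> osc f \<delta> i" using osc_nonneg assms by simp
  let ?I = "{real i * \<delta>..(real i + 1) * \<delta>}"
  fix x y assume xy: "x \<in> ?I" "y \<in> ?I"
  consider "clip a b x = clip a b y" | "clip a b x \<in> ?I" "clip a b y \<in> ?I"
    using xy assms(3) unfolding atLeastAtMost_iff by (smt (verit))
  then show "\<bar>f (clip a b x) - f (clip a b y)\<bar> \<le> osc f \<delta> i"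
    by cases (use abs_diff_le_osc[OF assms(1)] \<open>0 \<le> osc f \<delta> i\<close> in auto)
qed

lemma osc_sum_add_le:
  assumes "continuous_on UNIV f" "continuous_on UNIV g" "0 < \<delta>"
  shows "osc_sum (\<lambda>x. f x + g x) \<delta> \<le> osc_sum f \<delta> + osc_sum g \<delta>"
  unfolding osc_sum_def sum.distrib[symmetric] by (intro sum_mono osc_add_le assms)

lemma osc_sum_scale_le:
  assumes "continuous_on UNIV f" "0 < \<delta>"
  shows "osc_sum (\<lambda>x. c * f x) \<delta> \<le> \<bar>c\<bar> * osc_sum f \<delta>"
  unfolding osc_sum_def sum_distrib_left by (intro sum_mono osc_scale_le assms)

lemma osc_sum_clamp_le:
  assumes "continuous_on UNIV f" "0 < \<delta>" "a \<le> b"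
  shows "osc_sum (\<lambda>x. f (clip a b x)) \<delta> \<le> osc_sum f \<delta>"
  unfolding osc_sum_def by (intro sum_mono osc_clamp_le assms)

text \<open>Only columns that meet [a, b] contribute, and there are at most (b - a) / \<delta> + 2
  of them. This is the source of all upper bounds for concrete functions.\<close>

lemma osc_sum_le_local:
  assumes "0 < \<delta>" "a \<le> b" "0 \<le> H"
    and clamp: "\<And>x. f x = f (clip a b x)"
    and H: "\<And>x y. \<bar>x - y\<bar> \<le> \<delta> \<Longrightarrow> \<bar>f x - f y\<bar> \<le> H"
  shows "osc_sum f \<delta> \<le> ((b - a) / \<delta> + 2) * H"
proof -
  let ?S = "{i::nat. a \<le> (real i + 1) * \<delta> \<and> real i * \<delta> \<le> b}"
  note fin = card_grid_le(1)[OF assms(2,1)]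
  have "osc f \<delta> i \<le> (if i \<in> ?S then H else 0)" for i
  proof (rule osc_le)
    fix x y assume xy: "x \<in> {real i * \<delta>..(real i + 1) * \<delta>}" "y \<in> {real i * \<delta>..(real i + 1) * \<delta>}"
    then have "\<bar>x - y\<bar> \<le> \<delta>" by (auto simp: algebra_simps abs_le_iff)
    moreover have "f x = f y" if "i \<notin> ?S"
    proof -
      have "clip a b x = clip a b y" using that xy assms(2) by (auto simp: max_def min_def)
      then show ?thesis using clamp by metis
    qed
    ultimately show "\<bar>f x - f y\<bar> \<le> (if i \<in> ?S then H else 0)" using H by auto
  qed (use assms in auto)
  then have "osc_sum f \<delta> \<le> (\<Sum>i\<le>nat \<lfloor>1 / \<delta>\<rfloor>. if i \<in> ?S then H else 0)"
    unfolding osc_sum_def by (rule sum_mono)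
  also have "\<dots> = real (card ({..nat \<lfloor>1 / \<delta>\<rfloor>} \<inter> ?S)) * H"
    by (subst sum.inter_restrict[symmetric]) auto
  also have "\<dots> \<le> real (card ?S) * H"
    using fin assms by (intro mult_right_mono) (auto intro!: card_mono)
  also have "\<dots> \<le> ((b - a) / \<delta> + 2) * H"
    using card_grid_le(2)[OF assms(2,1)] assms by (intro mult_right_mono) auto
  finally show ?thesis .
qed

text \<open>A column of oscillation H takes about H / \<delta> squares of side \<delta>, so a sum of
  order \<delta>^(1-u) stands for \<delta>^(-u) squares. The slack u > t absorbs constants and
  logarithms.\<close>

definition osc_growth :: "real \<Rightarrow> (real \<Rightarrow> real) \<Rightarrow> bool" where
  "osc_growth t f \<longleftrightarrow> (\<forall>u>t. \<forall>\<^sub>F \<delta> in at_right 0. osc_sum f \<delta> \<le> \<delta> powr (1 - u))"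

lemma eventually_const_powr_le:
  fixes C u v :: real
  assumes "u < v"
  shows "\<forall>\<^sub>F \<delta> in at_right 0. C * \<delta> powr (1 - u) \<le> \<delta> powr (1 - v)"
proof -
  have "((\<lambda>\<delta>::real. C * \<delta> powr (v - u)) \<longlongrightarrow> C * 0) (at_right 0)"
    using assms
    by (intro tendsto_mult tendsto_const tendsto_eq_rhs[OF tendsto_powr'[where b = "v - u"]])
      (auto simp: eventually_at_filter)
  then have "\<forall>\<^sub>F \<delta> in at_right 0. C * \<delta> powr (v - u) < 1"
    by (intro order_tendstoD(2)) auto
  with eventually_at_right_less[of 0] show ?thesis
  proof eventually_elim
    case (elim \<delta>)
    have "C * \<delta> powr (1 - u) = (C * \<delta> powr (v - u)) * \<delta> powr (1 - v)"
      by (simp flip: powr_add)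
    also have "\<dots> \<le> 1 * \<delta> powr (1 - v)"
      using elim by (intro mult_right_mono) auto
    finally show ?case by simp
  qed
qed

text \<open>An exponent strictly between t and u leaves a positive power of \<delta> to absorb
  C.\<close>

lemma osc_growthI:
  assumes "\<And>u. u > t \<Longrightarrow> \<exists>C. \<forall>\<^sub>F \<delta> in at_right 0. osc_sum f \<delta> \<le> C * \<delta> powr (1 - u)"
  shows "osc_growth t f"
  unfolding osc_growth_def
proof (intro allI impI)
  fix u assume "u > t"
  define v where "v = (t + u) / 2"
  have "t < v" "v < u" using \<open>u > t\<close> by (auto simp: v_def)
  from assms[OF this(1)] obtain C where "\<forall>\<^sub>F \<delta> in at_right 0. osc_sum f \<delta> \<le> C * \<delta> powr (1 - v)" by blast
  with eventually_const_powr_le[OF \<open>v < u\<close>, of C]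
  show "\<forall>\<^sub>F \<delta> in at_right 0. osc_sum f \<delta> \<le> \<delta> powr (1 - u)"
    by eventually_elim linarith
qed

lemma osc_growth_add:
  assumes "continuous_on UNIV f" "continuous_on UNIV g" "osc_growth t f" "osc_growth t g"
  shows "osc_growth t (\<lambda>x. f x + g x)"
proof (rule osc_growthI)
  fix u assume "u > t"
  with assms(3,4) have "\<forall>\<^sub>F \<delta> in at_right 0. osc_sum f \<delta> \<le> \<delta> powr (1 - u)"
    "\<forall>\<^sub>F \<delta> in at_right 0. osc_sum g \<delta> \<le> \<delta> powr (1 - u)" by (auto simp: osc_growth_def)
  with eventually_at_right_less[of 0]
  have "\<forall>\<^sub>F \<delta> in at_right 0. osc_sum (\<lambda>x. f x + g x) \<delta> \<le> 2 * \<delta> powr (1 - u)"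
  proof eventually_elim
    case (elim \<delta>)
    with osc_sum_add_le[OF assms(1,2), of \<delta>] show ?case by linarith
  qed
  then show "\<exists>C. \<forall>\<^sub>F \<delta> in at_right 0. osc_sum (\<lambda>x. f x + g x) \<delta> \<le> C * \<delta> powr (1 - u)" by blast
qed

lemma osc_growth_scale:
  assumes "continuous_on UNIV f" "osc_growth t f"
  shows "osc_growth t (\<lambda>x. c * f x)"
proof (rule osc_growthI)
  fix u assume "u > t"
  with assms(2) have "\<forall>\<^sub>F \<delta> in at_right 0. osc_sum f \<delta> \<le> \<delta> powr (1 - u)"
    by (auto simp: osc_growth_def)
  with eventually_at_right_less[of 0]
  have "\<forall>\<^sub>F \<delta> in at_right 0. osc_sum (\<lambda>x. c * f x) \<delta> \<le> \<bar>c\<bar> * \<delta> powr (1 - u)"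
  proof eventually_elim
    case (elim \<delta>)
    have "\<bar>c\<bar> * osc_sum f \<delta> \<le> \<bar>c\<bar> * \<delta> powr (1 - u)" using elim by (intro mult_left_mono) auto
    with osc_sum_scale_le[OF assms(1), of \<delta> c] elim show ?case by linarith
  qed
  then show "\<exists>C. \<forall>\<^sub>F \<delta> in at_right 0. osc_sum (\<lambda>x. c * f x) \<delta> \<le> C * \<delta> powr (1 - u)" by blast
qed

lemma osc_growth_clamp:
  assumes "continuous_on UNIV f" "osc_growth t f" "a \<le> b"
  shows "osc_growth t (\<lambda>x. f (clip a b x))"
  unfolding osc_growth_def
proof (intro allI impI)
  fix u assume "u > t"
  with assms(2) have "\<forall>\<^sub>F \<delta> in at_right 0. osc_sum f \<delta> \<le> \<delta> powr (1 - u)"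
    by (auto simp: osc_growth_def)
  with eventually_at_right_less[of 0]
  show "\<forall>\<^sub>F \<delta> in at_right 0. osc_sum (\<lambda>x. f (clip a b x)) \<delta> \<le> \<delta> powr (1 - u)"
    by eventually_elim (use osc_sum_clamp_le[OF assms(1) _ assms(3)] order.trans in blast)
qed

lemma osc_growth_mono: "osc_growth t f \<Longrightarrow> t \<le> u \<Longrightarrow> osc_growth u f"
  by (auto simp: osc_growth_def)

section \<open>Covering numbers of graphs\<close>

text \<open>Subadditivity of Lebesgue measure; to be applied to the vertical projections of the sets
  that cover one column of a graph.\<close>

lemma length_le_interval_cover:
  fixes a b \<delta> :: real
  assumes "finite T" "{a..b} \<subseteq> (\<Union>u\<in>T. {c u - \<delta>..c u + \<delta>})" "0 < \<delta>"
  shows "b - a \<le> 2 * \<delta> * real (card T)"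
proof (cases "a \<le> b")
  case True
  have "b - a = measure lborel {a..b}" using True by simp
  also have "\<dots> \<le> measure lborel (\<Union>u\<in>T. {c u - \<delta>..c u + \<delta>})"
    using assms by (intro measure_mono_fmeasurable fmeasurable.finite_UN) (auto simp: fmeasurable_def)
  also have "\<dots> \<le> (\<Sum>u\<in>T. measure lborel {c u - \<delta>..c u + \<delta>})"
    using assms(1) by (intro measure_UNION_le) auto
  also have "\<dots> = 2 * \<delta> * real (card T)" using assms by simp
  finally show ?thesis .
next
  case False
  with assms(3) have "0 \<le> 2 * \<delta> * real (card T)" by simp
  with False show ?thesis by linarith
qed

lemma real_card_filter_eq_sum:
  "finite A \<Longrightarrow> real (card {x\<in>A. P x}) = (\<Sum>x\<in>A. if P x then 1 else 0)"
  by (simp add: sum.If_cases Int_def)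

text \<open>Double counting of the pairs of a column and a covering set that meets the graph there.
  The image of a column is an interval covered by projections of length at most 2 * \<delta>, and
  each set meets at most 4 columns, which gives the factor 8.\<close>

lemma osc_sum_le_card_cover:
  fixes f :: "real \<Rightarrow> real"
  assumes f: "continuous_on UNIV f" "\<And>x. f x = f (clip 0 1 x)" and "0 < \<delta>"
    and C: "finite C" "(\<lambda>x. (x, f x)) ` {0..1} \<subseteq> \<Union>C" "\<And>U. U \<in> C \<Longrightarrow> bounded U \<and> diameter U \<le> \<delta>"
  shows "osc_sum f \<delta> \<le> 8 * \<delta> * real (card C)"
proof -
  let ?I = "\<lambda>i. {real i * \<delta>..(real i + 1) * \<delta>}"
  define touch where "touch U i \<longleftrightarrow> (\<exists>x\<in>?I i \<inter> {0..1}. (x, f x) \<in> U)" for U and i :: nat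
  have dist_le: "dist p q \<le> \<delta>" if "U \<in> C" "p \<in> U" "q \<in> U" for p q U
    using diameter_bounded_bound[of U p q] C(3)[OF that(1)] that by auto
  have osc: "osc f \<delta> i \<le> 2 * \<delta> * real (card {U\<in>C. touch U i})" if i: "i \<le> nat \<lfloor>1 / \<delta>\<rfloor>" for i
  proof (rule osc_le)
    \<comment> \<open>Since every counted column starts at or before 1, clipping to [0, 1] keeps a
      point in its column; the cover says nothing about the graph beyond 1.\<close>
    have il: "real i * \<delta> \<le> 1"
    proof -
      have "real i \<le> real (nat \<lfloor>1 / \<delta>\<rfloor>)" using i by simp
      also have "\<dots> \<le> 1 / \<delta>" using \<open>0 < \<delta>\<close> by simp
      finally show ?thesis using \<open>0 < \<delta>\<close> by (simp add: field_simps)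
    qed
    have main: "f y - f x \<le> 2 * \<delta> * real (card {U\<in>C. touch U i})"
      if xy: "x \<in> ?I i" "y \<in> ?I i" for x y
    proof -
      have "0 \<le> real i * \<delta>" using \<open>0 < \<delta>\<close> by simp
      then have cl: "clip 0 1 x \<in> ?I i \<inter> {0..1}" "clip 0 1 y \<in> ?I i \<inter> {0..1}"
        using xy il by (auto simp: max_def min_def)
      let ?T = "{U\<in>C. touch U i}"
      \<comment> \<open>The height of an arbitrary point of the set: by the diameter bound, all
        other heights lie within \<delta> of it. Only sets that touch the column, hence nonempty
        ones, are used.\<close>
      define c where "c U = snd (SOME p. p \<in> U)" for U :: "(real \<times> real) set"
      have "{f x..f y} \<subseteq> f ` (?I i \<inter> {0..1})"
      proof -
        have "connected (f ` (?I i \<inter> {0..1}))"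
          by (intro connected_continuous_image continuous_on_subset[OF f(1)] convex_connected
              convex_Int convex_real_interval) simp
        moreover have "f x \<in> f ` (?I i \<inter> {0..1})" "f y \<in> f ` (?I i \<inter> {0..1})"
          using cl f(2)[of x] f(2)[of y] by (simp_all only: imageI)
        ultimately show ?thesis by (rule connected_contains_Icc)
      qed
      also have "\<dots> \<subseteq> (\<Union>U\<in>?T. {c U - \<delta>..c U + \<delta>})"
      proof safe
        fix z assume z: "z \<in> ?I i" "z \<in> {0..1}"
        with C(2) obtain U where U: "U \<in> C" "(z, f z) \<in> U" by blast
        then have "(SOME p. p \<in> U) \<in> U" by (meson someI)
        from dist_le[OF U(1) this U(2)] have "dist (c U) (f z) \<le> \<delta>"
          unfolding c_def using dist_snd_le[of "SOME p. p \<in> U" "(z, f z)"] by simp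
        then have "f z \<in> {c U - \<delta>..c U + \<delta>}" by (auto simp: dist_real_def abs_le_iff)
        moreover have "U \<in> ?T" using U z by (auto simp: touch_def)
        ultimately show "f z \<in> (\<Union>U\<in>?T. {c U - \<delta>..c U + \<delta>})" by blast
      qed
      finally show ?thesis
        using C(1) \<open>0 < \<delta>\<close> by (intro length_le_interval_cover) auto
    qed
    show "\<bar>f x - f y\<bar> \<le> 2 * \<delta> * real (card {U\<in>C. touch U i})"
      if xy: "x \<in> ?I i" "y \<in> ?I i" for x y
      using main[OF xy] main[OF xy(2,1)] by linarith
  qed (use \<open>0 < \<delta>\<close> in simp)
  \<comment> \<open>Around any point p of U, all abscissae lie in an interval of length 2 *
    \<delta>, and the grid count adds 2.\<close>
  have card4: "real (card {i. i \<le> nat \<lfloor>1 / \<delta>\<rfloor> \<and> touch U i}) \<le> 4" if U: "U \<in> C" for U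
  proof (cases "\<exists>p. p \<in> U")
    case True
    then obtain p where p: "p \<in> U" by blast
    let ?S = "{i::nat. fst p - \<delta> \<le> (real i + 1) * \<delta> \<and> real i * \<delta> \<le> fst p + \<delta>}"
    have "{i. i \<le> nat \<lfloor>1 / \<delta>\<rfloor> \<and> touch U i} \<subseteq> ?S"
    proof safe
      fix i assume "touch U i"
      then obtain x where x: "x \<in> ?I i" "(x, f x) \<in> U" by (auto simp: touch_def)
      have "dist (fst p) x \<le> \<delta>"
        using dist_le[OF U p x(2)] dist_fst_le[of p "(x, f x)"] by simp
      then show "fst p - \<delta> \<le> (real i + 1) * \<delta>" "real i * \<delta> \<le> fst p + \<delta>"
        using x(1) by (auto simp: dist_real_def abs_le_iff)
    qed
    then have "card {i. i \<le> nat \<lfloor>1 / \<delta>\<rfloor> \<and> touch U i} \<le> card ?S"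
      using \<open>0 < \<delta>\<close> by (intro card_mono card_grid_le(1)) auto
    also have "real (card ?S) \<le> ((fst p + \<delta>) - (fst p - \<delta>)) / \<delta> + 2"
      using \<open>0 < \<delta>\<close> by (intro card_grid_le(2)) auto
    also have "\<dots> = 4" using \<open>0 < \<delta>\<close> by (simp add: field_simps)
    finally show ?thesis by simp
  next
    case False
    then have "\<not> touch U i" for i by (auto simp: touch_def)
    then show ?thesis by simp
  qed
  have "osc_sum f \<delta> \<le> (\<Sum>i\<le>nat \<lfloor>1 / \<delta>\<rfloor>. 2 * \<delta> * real (card {U\<in>C. touch U i}))"
    unfolding osc_sum_def by (intro sum_mono osc) simp
  also have "\<dots> = 2 * \<delta> * (\<Sum>i\<le>nat \<lfloor>1 / \<delta>\<rfloor>. \<Sum>U\<in>C. if touch U i then 1 else 0)"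
    unfolding sum_distrib_left[symmetric] using C(1) by (simp add: real_card_filter_eq_sum)
  also have "\<dots> = 2 * \<delta> * (\<Sum>U\<in>C. real (card {i\<in>{..nat \<lfloor>1 / \<delta>\<rfloor>}. touch U i}))"
    by (subst sum.swap) (simp only: real_card_filter_eq_sum[OF finite_atMost])
  also have "\<dots> \<le> 2 * \<delta> * (\<Sum>U\<in>C. 4)"
    using \<open>0 < \<delta>\<close> card4 by (intro mult_left_mono sum_mono) auto
  finally show ?thesis by simp
qed

text \<open>In each column, squares of side \<delta> are stacked upwards from the minimum of f,
  floor (osc / \<delta>) + 1 of them. The crude bound of the norm by the sum of both coordinates
  gives the diameter 2 * \<delta>.\<close>

lemma cover_graph_exists:
  fixes f :: "real \<Rightarrow> real"
  assumes f: "continuous_on UNIV f" and "0 < \<delta>"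
  obtains C where "finite C" "(\<lambda>x. (x, f x)) ` {0..1} \<subseteq> \<Union>C"
    "\<And>U. U \<in> C \<Longrightarrow> bounded U \<and> diameter U \<le> 2 * \<delta>"
    "real (card C) \<le> osc_sum f \<delta> / \<delta> + 1 / \<delta> + 1"
proof -
  let ?I = "\<lambda>i. {real i * \<delta>..(real i + 1) * \<delta>}"
  let ?n = "nat \<lfloor>1 / \<delta>\<rfloor>"
  have "\<exists>m\<in>?I i. \<forall>y\<in>?I i. f m \<le> f y" for i
    using \<open>0 < \<delta>\<close> by (intro continuous_attains_inf continuous_on_subset[OF f]) auto
  then obtain m where m: "\<And>i. m i \<in> ?I i" "\<And>i y. y \<in> ?I i \<Longrightarrow> f (m i) \<le> f y" by metis
  define J where "J = Sigma {..?n} (\<lambda>i. {..nat \<lfloor>osc f \<delta> i / \<delta>\<rfloor>})"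
  define B where "B = (\<lambda>(i::nat,j::nat). ?I i \<times> {f (m i) + real j * \<delta>..f (m i) + (real j + 1) * \<delta>})"
  have osc0: "0 \<le> osc f \<delta> i" for i using osc_nonneg[OF f \<open>0 < \<delta>\<close>] .
  have finJ: "finite J" unfolding J_def by auto
  show ?thesis
  proof (rule that[of "B ` J"])
    show "finite (B ` J)" using finJ by simp
    show "(\<lambda>x. (x, f x)) ` {0..1} \<subseteq> \<Union> (B ` J)"
    proof safe
      fix x :: real assume x: "x \<in> {0..1}"
      define i where "i = nat \<lfloor>x / \<delta>\<rfloor>"
      have "real i \<le> x / \<delta>" "x / \<delta> < real i + 1"
        using x \<open>0 < \<delta>\<close> unfolding i_def by (auto simp: of_nat_nat)
      then have xi: "x \<in> ?I i" using \<open>0 < \<delta>\<close> by (auto simp: field_simps)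
      have "x / \<delta> \<le> 1 / \<delta>" using x \<open>0 < \<delta>\<close> by (simp add: divide_right_mono)
      then have i: "i \<le> ?n" unfolding i_def by (intro nat_mono floor_mono)
      define z where "z = (f x - f (m i)) / \<delta>"
      have z0: "0 \<le> z" using m(2)[OF xi] \<open>0 < \<delta>\<close> by (simp add: z_def)
      have "z \<le> osc f \<delta> i / \<delta>"
        using abs_diff_le_osc[OF f xi m(1)] \<open>0 < \<delta>\<close> unfolding z_def by (intro divide_right_mono) auto
      then have j: "nat \<lfloor>z\<rfloor> \<le> nat \<lfloor>osc f \<delta> i / \<delta>\<rfloor>" by (intro nat_mono floor_mono)
      have "real (nat \<lfloor>z\<rfloor>) \<le> z" "z \<le> real (nat \<lfloor>z\<rfloor>) + 1" using z0 by (auto simp: of_nat_nat)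
      then have "f x \<in> {f (m i) + real (nat \<lfloor>z\<rfloor>) * \<delta>..f (m i) + (real (nat \<lfloor>z\<rfloor>) + 1) * \<delta>}"
        using \<open>0 < \<delta>\<close> by (auto simp: z_def field_simps)
      with xi have "(x, f x) \<in> B (i, nat \<lfloor>z\<rfloor>)" by (simp add: B_def)
      moreover have "(i, nat \<lfloor>z\<rfloor>) \<in> J" using i j by (simp add: J_def)
      ultimately show "(x, f x) \<in> \<Union> (B ` J)" by blast
    qed
    show "bounded U \<and> diameter U \<le> 2 * \<delta>" if "U \<in> B ` J" for U
    proof -
      obtain a b :: real where U: "U = {a..a + \<delta>} \<times> {b..b + \<delta>}"
        using \<open>U \<in> B ` J\<close> by (force simp: B_def algebra_simps)
      have "diameter U \<le> 2 * \<delta>"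
      proof (rule diameter_le)
        show "U \<noteq> {} \<or> 0 \<le> 2 * \<delta>" using \<open>0 < \<delta>\<close> by simp
        fix p q assume pq: "p \<in> U" "q \<in> U"
        have "norm (p - q) = norm (fst (p - q), snd (p - q))" by (simp only: prod.collapse)
        also have "\<dots> \<le> norm (fst (p - q)) + norm (snd (p - q))" by (rule norm_Pair_le)
        also have "\<dots> \<le> \<delta> + \<delta>" using pq unfolding U by (intro add_mono) (auto simp: abs_le_iff)
        finally show "norm (p - q) \<le> 2 * \<delta>" by simp
      qed
      moreover have "bounded U" unfolding U by (intro bounded_Times) auto
      ultimately show ?thesis by blast
    qed
    have "real (card (B ` J)) \<le> real (card J)" using finJ by (simp add: card_image_le)
    also have "\<dots> = (\<Sum>i\<le>?n. real (nat \<lfloor>osc f \<delta> i / \<delta>\<rfloor>) + 1)"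
      unfolding J_def by (subst card_SigmaI) (auto simp: add.commute)
    also have "\<dots> \<le> (\<Sum>i\<le>?n. osc f \<delta> i / \<delta> + 1)"
      using osc0 \<open>0 < \<delta>\<close> by (intro sum_mono add_mono) (auto simp: of_nat_nat)
    also have "\<dots> = osc_sum f \<delta> / \<delta> + (real ?n + 1)"
      by (simp add: sum.distrib osc_sum_def sum_divide_distrib)
    also have "real ?n \<le> 1 / \<delta>" using \<open>0 < \<delta>\<close> by (simp add: of_nat_nat)
    finally show "real (card (B ` J)) \<le> osc_sum f \<delta> / \<delta> + 1 / \<delta> + 1" by simp
  qed
qed

section \<open>Minimal covers and the upper box dimension\<close>

lemma covering_number_le:
  assumes "finite C" "F \<subseteq> \<Union>C" "\<And>U. U \<in> C \<Longrightarrow> bounded U \<and> diameter U \<le> \<delta>"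
  shows "covering_number \<delta> F \<le> card C"
  unfolding covering_number_def using assms by (intro Least_le) blast

text \<open>The given finite cover shows that the predicate under \<open>LEAST\<close> is
  satisfiable, so the minimum is attained by an actual cover.\<close>

lemma covering_number_attained:
  assumes "finite C" "F \<subseteq> \<Union>C" "\<And>U. U \<in> C \<Longrightarrow> bounded U \<and> diameter U \<le> \<delta>"
  obtains D where "finite D" "card D = covering_number \<delta> F" "F \<subseteq> \<Union>D"
    "\<And>U. U \<in> D \<Longrightarrow> bounded U \<and> diameter U \<le> \<delta>"
proof -
  let ?P = "\<lambda>n. \<exists>D. finite D \<and> card D \<le> n \<and> F \<subseteq> \<Union>D \<and> (\<forall>U\<in>D. bounded U \<and> diameter U \<le> \<delta>)"
  have "?P (card C)" using assms by blast
  then have "?P (covering_number \<delta> F)" unfolding covering_number_def by (rule LeastI)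
  then obtain D where D: "finite D" "card D \<le> covering_number \<delta> F" "F \<subseteq> \<Union>D"
    "\<forall>U\<in>D. bounded U \<and> diameter U \<le> \<delta>" by blast
  with covering_number_le[OF D(1,3), of \<delta>] have "card D = covering_number \<delta> F" by fastforce
  with D that show ?thesis by blast
qed

lemma upper_box_dim_le_iff:
  assumes "0 \<le> t"
  shows "upper_box_dim F \<le> ereal t \<longleftrightarrow>
    (\<forall>u>t. \<forall>\<^sub>F \<delta> in at_right 0. real (covering_number \<delta> F) \<le> \<delta> powr (- u))"
proof -
  have iff: "real n \<le> \<delta> powr (- u) \<longleftrightarrow> ln (real n) / (- ln \<delta>) \<le> u"
    if \<delta>: "0 < \<delta>" "\<delta> < 1" and "0 < u" for n :: nat and \<delta> u :: real
  \<comment> \<open>For n = 0 both sides hold, since \<open>ln 0 = 0\<close> and u is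
    positive.\<close>
  proof (cases "n = 0")
    case False
    have "ln \<delta> < 0" using \<delta> by simp
    have "real n \<le> \<delta> powr (- u) \<longleftrightarrow> ln (real n) \<le> ln (\<delta> powr (- u))"
      using False \<delta> by (subst ln_le_cancel_iff) auto
    also have "\<dots> \<longleftrightarrow> ln (real n) \<le> u * (- ln \<delta>)" using \<delta> by (simp add: ln_powr)
    also have "\<dots> \<longleftrightarrow> ln (real n) / (- ln \<delta>) \<le> u"
      using \<open>ln \<delta> < 0\<close> by (subst pos_divide_le_eq) auto
    finally show ?thesis .
  qed (use \<open>0 < u\<close> in simp)
  have ev01: "\<forall>\<^sub>F \<delta> in at_right (0::real). 0 < \<delta> \<and> \<delta> < 1"
    by (auto simp: eventually_at_right_field intro!: exI[of _ 1])
  show ?thesis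
  proof
    assume le: "upper_box_dim F \<le> ereal t"
    show "\<forall>u>t. \<forall>\<^sub>F \<delta> in at_right 0. real (covering_number \<delta> F) \<le> \<delta> powr (- u)"
    proof (intro allI impI)
      fix u assume "t < u"
      then have "upper_box_dim F < ereal u" using le by (simp add: le_less_trans)
      then have "\<forall>\<^sub>F \<delta> in at_right 0. ereal (ln (real (covering_number \<delta> F)) / (- ln \<delta>)) < ereal u"
        unfolding upper_box_dim_def by (rule Limsup_lessD)
      with ev01 show "\<forall>\<^sub>F \<delta> in at_right 0. real (covering_number \<delta> F) \<le> \<delta> powr (- u)"
        proof eventually_elim
        case (elim \<delta>)
        then show ?case using iff[of \<delta> u] \<open>t < u\<close> assms by simp
      qed
    qed
  next
    assume ev: "\<forall>u>t. \<forall>\<^sub>F \<delta> in at_right 0. real (covering_number \<delta> F) \<le> \<delta> powr (- u)"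
    show "upper_box_dim F \<le> ereal t"
    proof (rule ereal_le_epsilon2)
      fix e :: real assume "0 < e"
      then have "\<forall>\<^sub>F \<delta> in at_right 0. real (covering_number \<delta> F) \<le> \<delta> powr (- (t + e))"
        using ev[rule_format, of "t + e"] by simp
      with ev01 have "\<forall>\<^sub>F \<delta> in at_right 0. ereal (ln (real (covering_number \<delta> F)) / (- ln \<delta>)) \<le> ereal (t + e)"
        proof eventually_elim
        case (elim \<delta>)
        then show ?case using iff[of \<delta> "t + e"] \<open>0 < e\<close> assms by simp
      qed
      then show "upper_box_dim F \<le> ereal t + ereal e"
        unfolding upper_box_dim_def by (simp add: Limsup_bounded)
    qed
  qed
qed

text \<open>The threshold 1 is the contribution of the 1 / \<delta> columns themselves.\<close>

lemma upper_box_dim_graph_le_iff: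
  fixes f :: "real \<Rightarrow> real"
  assumes f: "continuous_on UNIV f" "\<And>x. f x = f (clip 0 1 x)" and "1 \<le> t"
  shows "upper_box_dim ((\<lambda>x. (x, f x)) ` {0..1}) \<le> ereal t \<longleftrightarrow> osc_growth t f"
proof -
  let ?F = "(\<lambda>x. (x, f x)) ` {0..1}"
  have "0 \<le> t" using assms by simp
  have low: "osc_sum f \<delta> \<le> 8 * \<delta> * real (covering_number \<delta> ?F)" if "0 < \<delta>" for \<delta>
  proof -
    \<comment> \<open>A cover built at \<delta> / 2 has diameters up to \<delta>. It serves only to
      show that the covering number is attained at scale \<delta>.\<close>
    have "0 < \<delta> / 2" using that by simp
    from cover_graph_exists[OF f(1) this] obtain C where C: "finite C" "?F \<subseteq> \<Union>C"
      "\<And>U. U \<in> C \<Longrightarrow> bounded U \<and> diameter U \<le> 2 * (\<delta> / 2)" by metis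
    then have "\<And>U. U \<in> C \<Longrightarrow> bounded U \<and> diameter U \<le> \<delta>" by simp
    from covering_number_attained[OF C(1,2) this] obtain D where "finite D"
      "card D = covering_number \<delta> ?F" "?F \<subseteq> \<Union>D"
      "\<And>U. U \<in> D \<Longrightarrow> bounded U \<and> diameter U \<le> \<delta>" by metis
    with osc_sum_le_card_cover[OF f that, of D] show ?thesis by simp
  qed
  have up: "real (covering_number (2 * \<delta>) ?F) \<le> osc_sum f \<delta> / \<delta> + 1 / \<delta> + 1" if "0 < \<delta>" for \<delta>
  proof -
    obtain C where C: "finite C" "?F \<subseteq> \<Union>C" "\<And>U. U \<in> C \<Longrightarrow> bounded U \<and> diameter U \<le> 2 * \<delta>"
       "real (card C) \<le> osc_sum f \<delta> / \<delta> + 1 / \<delta> + 1"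
      using cover_graph_exists[OF f(1) \<open>0 < \<delta>\<close>] by metis
    with covering_number_le[OF C(1,2,3)] show ?thesis by linarith
  qed
  show ?thesis unfolding upper_box_dim_le_iff[OF \<open>0 \<le> t\<close>]
  proof
    assume ev: "\<forall>u>t. \<forall>\<^sub>F \<delta> in at_right 0. real (covering_number \<delta> ?F) \<le> \<delta> powr (- u)"
    show "osc_growth t f"
    proof (rule osc_growthI)
      fix u assume "u > t"
      with ev have "\<forall>\<^sub>F \<delta> in at_right 0. real (covering_number \<delta> ?F) \<le> \<delta> powr (- u)" by blast
      with eventually_at_right_less[of 0]
      have "\<forall>\<^sub>F \<delta> in at_right 0. osc_sum f \<delta> \<le> 8 * \<delta> powr (1 - u)"
      proof eventually_elim
        case (elim \<delta>)
        have "osc_sum f \<delta> \<le> 8 * \<delta> * real (covering_number \<delta> ?F)" using low elim by simp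
        also have "\<dots> \<le> 8 * \<delta> * \<delta> powr (- u)" using elim by (intro mult_left_mono) auto
        also have "\<dots> = 8 * \<delta> powr (1 - u)"
          using elim by (simp add: powr_diff powr_minus divide_inverse)
        finally show ?case .
      qed
      then show "\<exists>C. \<forall>\<^sub>F \<delta> in at_right 0. osc_sum f \<delta> \<le> C * \<delta> powr (1 - u)" by blast
    qed
  next
    assume gr: "osc_growth t f"
    show "\<forall>u>t. \<forall>\<^sub>F \<delta> in at_right 0. real (covering_number \<delta> ?F) \<le> \<delta> powr (- u)"
    proof (intro allI impI)
      fix u assume "u > t"
      define v where "v = (t + u) / 2"
      have v: "t < v" "v < u" "1 < v" using \<open>u > t\<close> \<open>1 \<le> t\<close> by (auto simp: v_def)
      have "\<forall>\<^sub>F \<delta> in at_right 0. osc_sum f \<delta> \<le> \<delta> powr (1 - v)"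
        using gr v by (auto simp: osc_growth_def)
      moreover have "\<forall>\<^sub>F \<delta>::real in at_right 0. \<delta> < 1"
        by (auto simp: eventually_at_right_field intro!: exI[of _ 1])
      moreover note eventually_at_right_less[of 0]
      \<comment> \<open>The 3 is for the three summands of \<open>up\<close>, each at most
        \<delta>^(1-v) / \<delta>; the factor 2^u pays for passing from \<delta> to 2 *
        \<delta>.\<close>
      moreover note eventually_const_powr_le[OF v(2), of "3 * 2 powr u"]
      ultimately have "\<forall>\<^sub>F \<delta> in at_right 0. real (covering_number (2 * \<delta>) ?F) \<le> (2 * \<delta>) powr (- u)"
      proof eventually_elim
        case (elim \<delta>)
        have "1 = \<delta> powr 0" using elim by simp
        also have "\<dots> \<le> \<delta> powr (1 - v)" using elim v by (intro powr_mono') auto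
        finally have 1: "1 \<le> \<delta> powr (1 - v)" .
        have d: "\<delta> powr (1 - v) / \<delta> \<ge> \<delta> powr (1 - v)"
          using elim by (simp add: field_simps mult_left_le)
        have "real (covering_number (2 * \<delta>) ?F) \<le> osc_sum f \<delta> / \<delta> + 1 / \<delta> + 1" using up elim by simp
        also have "\<dots> \<le> \<delta> powr (1 - v) / \<delta> + \<delta> powr (1 - v) / \<delta> + \<delta> powr (1 - v) / \<delta>"
          using elim 1 d by (intro add_mono divide_right_mono) auto
        also have "\<dots> = (3 * \<delta> powr (1 - v)) / \<delta>" by simp
        also have "\<dots> = 2 powr (- u) * (3 * 2 powr u * \<delta> powr (1 - v)) / \<delta>"
          by (simp add: powr_minus)
        also have "\<dots> \<le> 2 powr (- u) * \<delta> powr (1 - u) / \<delta>"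
          using elim by (intro divide_right_mono mult_left_mono) auto
        also have "\<dots> = (2 * \<delta>) powr (- u)"
          using elim by (simp add: powr_mult powr_diff powr_minus divide_inverse)
        finally show ?case .
      qed
      then obtain b where b: "0 < b" "\<And>\<delta>. 0 < \<delta> \<Longrightarrow> \<delta> < b \<Longrightarrow>
          real (covering_number (2 * \<delta>) ?F) \<le> (2 * \<delta>) powr (- u)"
        by (auto simp: eventually_at_right_field)
      show "\<forall>\<^sub>F \<delta> in at_right 0. real (covering_number \<delta> ?F) \<le> \<delta> powr (- u)"
        unfolding eventually_at_right_field
        using b(1) b(2)[of "_ / 2"] by (intro exI[of _ "2 * b"]) auto
    qed
  qed
qed

section \<open>A Takagi-type function\<close>

text \<open>The distance to the nearest integer, a triangle wave of period 1.\<close>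

definition tent :: "real \<Rightarrow> real" where
  "tent x = \<bar>x - of_int (round x)\<bar>"

lemma tent_le_dist_int: "tent x \<le> \<bar>x - of_int n\<bar>"
  unfolding tent_def by (rule round_diff_minimal)

lemma tent_bounds: "0 \<le> tent x" "tent x \<le> 1 / 2"
  using of_int_round_abs_le[of x] by (auto simp: tent_def abs_minus_commute)

lemma tent_lipschitz: "\<bar>tent x - tent y\<bar> \<le> \<bar>x - y\<bar>"
proof -
  have "tent a \<le> \<bar>a - b\<bar> + tent b" for a b
    using tent_le_dist_int[of a "round b"] by (simp add: tent_def)
  from this[of x y] this[of y x] show ?thesis by linarith
qed

lemma tent_of_int: "tent (of_int n) = 0"
  using tent_le_dist_int[of "of_int n" n] tent_bounds(1)[of "of_int n"] by simp

lemma tent_eq: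
  assumes "of_int n \<le> x" "x \<le> of_int n + 1"
  shows "tent x = min (x - of_int n) (of_int n + 1 - x)"
proof (rule antisym)
  show "tent x \<le> min (x - of_int n) (of_int n + 1 - x)"
    using tent_le_dist_int[of x n] tent_le_dist_int[of x "n + 1"] assms by simp
  have "real_of_int (round x) \<le> of_int n \<or> of_int n + 1 \<le> real_of_int (round x)"
  proof -
    have "round x \<le> n \<or> n + 1 \<le> round x" by linarith
    then show ?thesis by (metis of_int_1 of_int_add of_int_le_iff)
  qed
  then show "min (x - of_int n) (of_int n + 1 - x) \<le> tent x"
    unfolding tent_def using assms by linarith
qed

text \<open>The breakpoints of the wave are the half integers: it rises on cells with even j and
  falls on those with odd j. Second differences need affinity only in this midpoint form.\<close>

lemma tent_affine:
  assumes "of_int j / 2 \<le> l" "l \<le> r" "r \<le> (of_int j + 1) / 2"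
  shows "tent ((l + r) / 2) = (tent l + tent r) / 2"
proof -
  define n where "n = j div 2"
  have "j = 2 * n \<or> j = 2 * n + 1" unfolding n_def by presburger
  then have "real_of_int j = 2 * of_int n \<or> real_of_int j = 2 * of_int n + 1" by auto
  then consider "of_int n \<le> l" "r \<le> of_int n + 1 / 2" | "of_int n + 1 / 2 \<le> l" "r \<le> of_int n + 1"
  proof
    assume "real_of_int j = 2 * of_int n"
    then show ?thesis using assms by (intro that(1)) auto
  next
    assume "real_of_int j = 2 * of_int n + 1"
    then show ?thesis using assms by (intro that(2)) (auto simp: field_simps)
  qed
  then show ?thesis
    by cases (use assms(2) in \<open>simp_all add: tent_eq[of n] min_def field_simps\<close>)
qed

text \<open>Multiplication by 2^n sends the dyadic interval into one half-integer cell if n < m,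
  onto a unit interval if n = m, and all three points to integers if n > m.\<close>

lemma tent_second_difference:
  fixes i :: int
  shows "tent (2 ^ n * ((2 * of_int i + 1) / 2 ^ (m + 1)))
    - (tent (2 ^ n * (of_int i / 2 ^ m)) + tent (2 ^ n * ((of_int i + 1) / 2 ^ m))) / 2
    = (if n = m then 1 / 2 else 0)"
proof -
  consider "n < m" | "n = m" | "m < n" by linarith
  then show ?thesis
  proof cases
    case 1
    then obtain d where m: "m = n + Suc d" using less_iff_Suc_add by auto
    \<comment> \<open>The index of the half-integer cell that contains the scaled interval from i /
      2^(d+1) to (i + 1) / 2^(d+1).\<close>
    define j where "j = i div 2 ^ d"
    have "j * 2 ^ d \<le> i" "i + 1 \<le> (j + 1) * 2 ^ d"
    proof -
      have "i = j * 2 ^ d + i mod 2 ^ d" unfolding j_def by (rule div_mult_mod_eq[symmetric])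
      moreover have "0 \<le> i mod 2 ^ d" "i mod 2 ^ d < 2 ^ d" by simp_all
      moreover have "(j + 1) * 2 ^ d = j * 2 ^ d + 2 ^ d" by (simp add: algebra_simps)
      ultimately show "j * 2 ^ d \<le> i" "i + 1 \<le> (j + 1) * 2 ^ d" by linarith+
    qed
    then have "real_of_int (j * 2 ^ d) \<le> of_int i" "real_of_int (i + 1) \<le> of_int ((j + 1) * 2 ^ d)"
      by (simp_all only: of_int_le_iff)
    then have "tent ((of_int i / 2 ^ Suc d + (of_int i + 1) / 2 ^ Suc d) / 2)
      = (tent (of_int i / 2 ^ Suc d) + tent ((of_int i + 1) / 2 ^ Suc d)) / 2"
      by (intro tent_affine[of j]) (auto simp: field_simps)
    moreover have "2 ^ n * ((2 * real_of_int i + 1) / 2 ^ (m + 1))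
        = (of_int i / 2 ^ Suc d + (of_int i + 1) / 2 ^ Suc d) / 2"
      "2 ^ n * (real_of_int i / 2 ^ m) = of_int i / 2 ^ Suc d"
      "2 ^ n * ((real_of_int i + 1) / 2 ^ m) = (of_int i + 1) / 2 ^ Suc d"
      using m by (simp_all add: power_add field_simps)
    ultimately show ?thesis using m by (simp only:) simp
  next
    case 2
    have "tent (of_int i + 1 / 2) = 1 / 2" using tent_eq[of i "of_int i + 1 / 2"] by simp
    moreover have "tent (of_int i + 1) = 0" using tent_of_int[of "i + 1"] by simp
    moreover have "2 ^ n * ((2 * real_of_int i + 1) / 2 ^ (m + 1)) = of_int i + 1 / 2"
      "2 ^ n * (real_of_int i / 2 ^ m) = of_int i"
      "2 ^ n * ((real_of_int i + 1) / 2 ^ m) = of_int i + 1"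
      using 2 by (simp_all add: field_simps)
    ultimately show ?thesis using 2 tent_of_int[of i] by (simp only:) simp
  next
    case 3
    then obtain d where n: "n = m + Suc d" using less_iff_Suc_add by auto
    have "2 ^ n * ((2 * real_of_int i + 1) / 2 ^ (m + 1)) = of_int (2 ^ d * (2 * i + 1))"
      "2 ^ n * (real_of_int i / 2 ^ m) = of_int (2 ^ Suc d * i)"
      "2 ^ n * ((real_of_int i + 1) / 2 ^ m) = of_int (2 ^ Suc d * (i + 1))"
      using n by (simp_all add: power_add)
    then show ?thesis using 3 by (simp only: tent_of_int) simp
  qed
qed

text \<open>The factor (n + 1)^(-2) makes the series summable also for \<gamma> = 0, where the graph has
  dimension 2, without changing the exponential growth rate.\<close>

definition takagi_coeff :: "real \<Rightarrow> nat \<Rightarrow> real" where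
  "takagi_coeff \<gamma> n = 2 powr (- \<gamma> * real n) / (real n + 1)\<^sup>2"

definition takagi :: "real \<Rightarrow> real \<Rightarrow> real" where
  "takagi \<gamma> x = (\<Sum>n. takagi_coeff \<gamma> n * tent (2 ^ n * x))"

text \<open>The value is pi^2 / 6. It bounds both the Takagi-type functions and their Hoelder
  constants, uniformly in \<gamma>.\<close>

definition inv_sq_sum :: real where
  "inv_sq_sum = (\<Sum>n. 1 / (real n + 1)\<^sup>2)"

lemma summable_inv_sq: "summable (\<lambda>n. 1 / (real n + 1)\<^sup>2)"
proof -
  have "summable (\<lambda>n. inverse (real (Suc n) ^ 2))"
    using inverse_power_summable[of 2, where 'a = real] by (subst summable_Suc_iff) simp
  then show ?thesis by (simp add: divide_inverse add.commute)
qed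

lemma inv_sq_sum_nonneg: "0 \<le> inv_sq_sum"
  unfolding inv_sq_sum_def by (intro suminf_nonneg summable_inv_sq) simp

lemma takagi_coeff_pos: "0 < takagi_coeff \<gamma> n"
  by (simp add: takagi_coeff_def)

lemma takagi_term_bound:
  assumes "0 \<le> \<gamma>"
  shows "norm (takagi_coeff \<gamma> n * tent y) \<le> 1 / (real n + 1)\<^sup>2"
proof -
  have "takagi_coeff \<gamma> n \<le> 1 / (real n + 1)\<^sup>2"
    unfolding takagi_coeff_def using assms powr_mono[of "- \<gamma> * real n" 0 2]
    by (intro divide_right_mono) auto
  moreover have "takagi_coeff \<gamma> n * tent y \<le> takagi_coeff \<gamma> n"
    using takagi_coeff_pos[of \<gamma> n] tent_bounds[of y] by (intro mult_left_le) auto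
  ultimately show ?thesis
    using takagi_coeff_pos[of \<gamma> n] tent_bounds(1)[of y]
    unfolding real_norm_def abs_mult abs_of_pos[OF takagi_coeff_pos] abs_of_nonneg[OF tent_bounds(1)]
    by linarith
qed

lemma takagi_summable:
  assumes "0 \<le> \<gamma>"
  shows "summable (\<lambda>n. takagi_coeff \<gamma> n * tent (y n))"
  using takagi_term_bound[OF assms] by (intro summable_comparison_test[OF _ summable_inv_sq]) auto

lemma takagi_abs_le:
  assumes "0 \<le> \<gamma>"
  shows "\<bar>takagi \<gamma> x\<bar> \<le> inv_sq_sum"
  unfolding takagi_def inv_sq_sum_def real_norm_def[symmetric]
  by (intro norm_suminf_le takagi_term_bound assms summable_inv_sq)

lemma continuous_on_takagi:
  assumes "0 \<le> \<gamma>"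
  shows "continuous_on UNIV (takagi \<gamma>)"
proof -
  have "continuous_on UNIV tent"
    using tent_lipschitz by (intro lipschitz_on_continuous_on[of 1] lipschitz_onI) (auto simp: dist_real_def)
  then have "continuous_on UNIV (\<lambda>x. tent (2 ^ n * x))" for n
    by (rule continuous_on_compose2) (auto intro!: continuous_intros)
  moreover have "uniform_limit UNIV (\<lambda>N x. \<Sum>n<N. takagi_coeff \<gamma> n * tent (2 ^ n * x)) (takagi \<gamma>) sequentially"
    unfolding takagi_def by (intro Weierstrass_m_test[OF _ summable_inv_sq] takagi_term_bound assms)
  ultimately show ?thesis
    by (intro uniform_limit_theorem[where F = sequentially]) (auto intro!: continuous_intros always_eventually)
qed

lemma takagi_of_int: "takagi \<gamma> (of_int n) = 0"
proof -
  have "tent (2 ^ k * of_int n) = 0" for k using tent_of_int[of "2 ^ k * n"] by simp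
  then show ?thesis by (simp add: takagi_def)
qed

text \<open>With z = 2^n * |x - y|, the n-th tents differ by at most min z 1, hence by at most
  z^\<gamma>. The factor 2^(\<gamma> n) in it cancels against the coefficient and leaves a summable
  inverse square.\<close>

lemma takagi_holder:
  assumes "0 \<le> \<gamma>" "\<gamma> \<le> 1"
  shows "\<bar>takagi \<gamma> x - takagi \<gamma> y\<bar> \<le> inv_sq_sum * \<bar>x - y\<bar> powr \<gamma>"
proof (cases "x = y")
  case False
  define d where "d = \<bar>x - y\<bar>"
  have "0 < d" using False by (simp add: d_def)
  have bound: "norm (takagi_coeff \<gamma> n * (tent (2 ^ n * x) - tent (2 ^ n * y)))
      \<le> 1 / (real n + 1)\<^sup>2 * d powr \<gamma>" for n
  proof -
    let ?z = "2 ^ n * d"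
    have "0 < ?z" using \<open>0 < d\<close> by simp
    have "\<bar>tent (2 ^ n * x) - tent (2 ^ n * y)\<bar> \<le> ?z"
      using tent_lipschitz[of "2 ^ n * x" "2 ^ n * y"] by (simp add: d_def abs_mult flip: right_diff_distrib)
    moreover have "\<bar>tent (2 ^ n * x) - tent (2 ^ n * y)\<bar> \<le> 1"
      using tent_bounds[of "2 ^ n * x"] tent_bounds[of "2 ^ n * y"] by linarith
    moreover have "?z \<le> ?z powr \<gamma>" if "?z \<le> 1"
      using powr_mono'[of \<gamma> 1 ?z] that \<open>0 < ?z\<close> assms by simp
    moreover have "1 \<le> ?z powr \<gamma>" if "1 \<le> ?z"
      using that assms by (simp add: ge_one_powr_ge_zero)
    ultimately have le: "\<bar>tent (2 ^ n * x) - tent (2 ^ n * y)\<bar> \<le> ?z powr \<gamma>" by linarith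
    have "norm (takagi_coeff \<gamma> n * (tent (2 ^ n * x) - tent (2 ^ n * y)))
      \<le> takagi_coeff \<gamma> n * ?z powr \<gamma>"
      using le takagi_coeff_pos[of \<gamma> n] by (simp add: abs_mult)
    also have "?z powr \<gamma> = 2 powr (\<gamma> * real n) * d powr \<gamma>"
      using \<open>0 < d\<close> by (simp add: powr_mult powr_powr mult.commute flip: powr_realpow)
    also have "takagi_coeff \<gamma> n * (2 powr (\<gamma> * real n) * d powr \<gamma>) = 1 / (real n + 1)\<^sup>2 * d powr \<gamma>"
      by (simp add: takagi_coeff_def powr_minus)
    finally show ?thesis .
  qed
  have "takagi \<gamma> x - takagi \<gamma> y = (\<Sum>n. takagi_coeff \<gamma> n * (tent (2 ^ n * x) - tent (2 ^ n * y)))"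
    unfolding takagi_def right_diff_distrib by (intro suminf_diff takagi_summable assms)
  also have "norm \<dots> \<le> (\<Sum>n. 1 / (real n + 1)\<^sup>2 * d powr \<gamma>)"
    by (intro norm_suminf_le bound summable_mult2 summable_inv_sq)
  also have "\<dots> = inv_sq_sum * d powr \<gamma>"
    unfolding inv_sq_sum_def by (intro suminf_mult2[symmetric] summable_inv_sq)
  finally show ?thesis by (simp add: d_def)
qed simp

text \<open>The lower frequencies are affine on the dyadic interval and the higher ones vanish at the
  three points, so the second difference isolates one frequency.\<close>

lemma takagi_second_difference:
  fixes i :: int
  assumes "0 \<le> \<gamma>"
  shows "takagi \<gamma> ((2 * of_int i + 1) / 2 ^ (m + 1))
    - (takagi \<gamma> (of_int i / 2 ^ m) + takagi \<gamma> ((of_int i + 1) / 2 ^ m)) / 2 = takagi_coeff \<gamma> m / 2"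
proof -
  let ?c = "takagi_coeff \<gamma>"
  define T where "T x n = ?c n * tent (2 ^ n * x)" for x n
  have S: "(T x) sums takagi \<gamma> x" for x
    unfolding takagi_def T_def by (intro summable_sums takagi_summable assms)
  have "(\<lambda>n. T ((2 * of_int i + 1) / 2 ^ (m + 1)) n - (T (of_int i / 2 ^ m) n + T ((of_int i + 1) / 2 ^ m) n) / 2)
    sums (takagi \<gamma> ((2 * of_int i + 1) / 2 ^ (m + 1))
    - (takagi \<gamma> (of_int i / 2 ^ m) + takagi \<gamma> ((of_int i + 1) / 2 ^ m)) / 2)"
    by (intro sums_diff sums_divide sums_add S)
  moreover have "T ((2 * of_int i + 1) / 2 ^ (m + 1)) n - (T (of_int i / 2 ^ m) n + T ((of_int i + 1) / 2 ^ m) n) / 2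
    = (if n = m then ?c m / 2 else 0)" for n
  proof -
    have "T ((2 * of_int i + 1) / 2 ^ (m + 1)) n - (T (of_int i / 2 ^ m) n + T ((of_int i + 1) / 2 ^ m) n) / 2
      = ?c n * (tent (2 ^ n * ((2 * of_int i + 1) / 2 ^ (m + 1)))
    - (tent (2 ^ n * (of_int i / 2 ^ m)) + tent (2 ^ n * ((of_int i + 1) / 2 ^ m))) / 2)"
      unfolding T_def by (simp add: algebra_simps)
    then show ?thesis unfolding tent_second_difference by simp
  qed
  ultimately have S': "(\<lambda>n. if n = m then ?c m / 2 else 0) sums (takagi \<gamma> ((2 * of_int i + 1) / 2 ^ (m + 1))
    - (takagi \<gamma> (of_int i / 2 ^ m) + takagi \<gamma> ((of_int i + 1) / 2 ^ m)) / 2)" by (simp only:)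
  show ?thesis by (rule sums_unique2[OF S' sums_single])
qed

lemma takagi_half:
  assumes "0 \<le> \<gamma>"
  shows "takagi \<gamma> (of_int n + 1 / 2) = 1 / 2"
  using takagi_second_difference[OF assms, of n 0] takagi_of_int[of \<gamma> n] takagi_of_int[of \<gamma> "n + 1"]
  by (simp add: takagi_coeff_def add_divide_distrib)

section \<open>A closed space of block functions\<close>

lemma bounded_linear_apply_bcontfun: "bounded_linear (\<lambda>v. apply_bcontfun v x)"
  by (rule bounded_linear_intro[where K = 1]) (auto intro: norm_bounded)

lemma apply_bcontfun_Bcontfun:
  assumes "continuous_on UNIV f" "\<And>x. norm (f x) \<le> B"
  shows "apply_bcontfun (Bcontfun f) = f"
  using Bcontfun_inverse[OF bcontfun_normI[OF assms]] by simp

text \<open>Endpoints of the blocks: they decrease from 2 / 2^q to the limit 1 / 2^q, so the blocks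
  accumulate at the left end of the dyadic interval.\<close>

definition dyad :: "nat \<Rightarrow> nat \<Rightarrow> real" where
  "dyad q k = (1 + 1 / 2 ^ k) / 2 ^ q"

definition dyad_mid :: "nat \<Rightarrow> nat \<Rightarrow> real" where
  "dyad_mid q k = (dyad q (Suc k) + dyad q k) / 2"

lemma dyad_0: "dyad q 0 = 2 / 2 ^ q"
  by (simp add: dyad_def)

lemma dyad_gt: "1 / 2 ^ q < dyad q k"
  by (simp add: dyad_def divide_strict_right_mono)

lemma dyad_diff: "dyad q k - dyad q (Suc k) = 1 / 2 ^ (q + k + 1)"
  by (simp add: dyad_def power_add field_simps)

lemma dyad_Suc_less: "dyad q (Suc k) < dyad q k"
proof -
  have "0 < dyad q k - dyad q (Suc k)" unfolding dyad_diff by simp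
  then show ?thesis by simp
qed

lemma dyad_antimono: "j \<le> k \<Longrightarrow> dyad q k \<le> dyad q j"
  by (rule lift_Suc_antimono_le[of "dyad q"]) (rule less_imp_le[OF dyad_Suc_less])

text \<open>Scaling by the inverse block length turns the endpoints into consecutive integers, where
  the Takagi-type function is 0, and the midpoint into a half integer, where it is 1/2.\<close>

lemma dyad_scaled:
  "2 ^ (q + k + 1) * dyad q (Suc k) = of_int (2 ^ (k + 1) + 1)"
  "2 ^ (q + k + 1) * dyad q k = of_int (2 ^ (k + 1) + 2)"
  "2 ^ (q + k + 1) * dyad_mid q k = of_int (2 ^ (k + 1) + 1) + 1 / 2"
  by (simp_all add: dyad_def dyad_mid_def power_add field_simps)

lemma dyad_mid_bounds: "dyad q (Suc k) \<le> dyad_mid q k" "dyad_mid q k \<le> dyad q k"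
  using dyad_Suc_less[of q k] by (auto simp: dyad_mid_def)

text \<open>The scalars are read off at the midpoints of the blocks, where the rescaled Takagi function is 1/2,
  so that all conditions are pointwise and linear and the space is closed.\<close>

definition block_space :: "real \<Rightarrow> nat \<Rightarrow> (real \<Rightarrow>\<^sub>C real) set" where
  "block_space \<gamma> q = {v. (\<forall>x. x \<le> 1 / 2 ^ q \<or> 2 / 2 ^ q \<le> x \<longrightarrow> apply_bcontfun v x = 0) \<and>
     (\<forall>k. \<forall>x\<in>{dyad q (Suc k)..dyad q k}. apply_bcontfun v x =
        2 * apply_bcontfun v (dyad_mid q k) * takagi \<gamma> (2 ^ (q + k + 1) * x))}"

lemma block_space_outside:
  "v \<in> block_space \<gamma> q \<Longrightarrow> x \<le> 1 / 2 ^ q \<or> 2 / 2 ^ q \<le> x \<Longrightarrow> apply_bcontfun v x = 0"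
  by (auto simp: block_space_def)

lemma block_space_block:
  "v \<in> block_space \<gamma> q \<Longrightarrow> dyad q (Suc k) \<le> x \<Longrightarrow> x \<le> dyad q k \<Longrightarrow> apply_bcontfun v x =
        2 * apply_bcontfun v (dyad_mid q k) * takagi \<gamma> (2 ^ (q + k + 1) * x)"
  by (auto simp: block_space_def)

lemma block_space_dyad:
  assumes "v \<in> block_space \<gamma> q"
  shows "apply_bcontfun v (dyad q k) = 0"
  using block_space_block[OF assms, of k "dyad q k"] dyad_Suc_less[of q k]
  unfolding dyad_scaled takagi_of_int by simp

lemma closed_block_space: "closed (block_space \<gamma> q)"
proof -
  have [continuous_intros]: "continuous_on UNIV (\<lambda>v :: real \<Rightarrow>\<^sub>C real. apply_bcontfun v x)" for x
    by (rule linear_continuous_on[OF bounded_linear_apply_bcontfun])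
  show ?thesis unfolding block_space_def Ball_def
    by (intro closed_Collect_conj closed_Collect_all closed_Collect_imp open_Collect_const
        closed_Collect_eq continuous_intros)
qed

lemma subspace_block_space: "subspace (block_space \<gamma> q)"
  by (rule subspaceI) (auto simp: block_space_def algebra_simps)

lemma block_space_subset_C01:
  assumes "1 \<le> q"
  shows "block_space \<gamma> q \<subseteq> C01"
proof
  fix v assume v: "v \<in> block_space \<gamma> q"
  have q: "2 / 2 ^ q \<le> (1::real)" using assms power_increasing[of 1 q "2::real"] by simp
  have "apply_bcontfun v x = apply_bcontfun v (max 0 (min 1 x))" for x
  proof -
    have "x \<in> {0..1} \<or> x < 0 \<or> x > 1" by auto
    moreover have "apply_bcontfun v 0 = 0" "apply_bcontfun v 1 = 0"
      using q by (auto intro!: block_space_outside[OF v])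
    moreover have "apply_bcontfun v x = 0" if "x < 0"
      using that by (intro block_space_outside[OF v]) (auto intro: less_imp_le less_le_trans)
    moreover have "apply_bcontfun v x = 0" if "x > 1"
      using that q by (intro block_space_outside[OF v] disjI2) linarith
    ultimately show ?thesis by auto
  qed
  then show "v \<in> C01" by (simp add: C01_def)
qed

lemma osc_sum_block_le:
  assumes v: "v \<in> block_space \<gamma> q" and "0 \<le> \<gamma>" "\<gamma> \<le> 1" and \<delta>: "0 < \<delta>" "\<delta> \<le> 1 / 2 ^ (q + k + 1)"
  shows "osc_sum (\<lambda>x. apply_bcontfun v (clip (dyad q (Suc k)) (dyad q k) x)) \<delta>
    \<le> 6 * norm v * inv_sq_sum * \<delta> powr (\<gamma> - 1)"
proof -
  let ?L = "2 ^ (q + k + 1) :: real" and ?a = "dyad q (Suc k)" and ?b = "dyad q k"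
  let ?H = "2 * norm v * (inv_sq_sum * (?L * \<delta>) powr \<gamma>)"
  have H: "\<bar>apply_bcontfun v (clip ?a ?b x) - apply_bcontfun v (clip ?a ?b y)\<bar> \<le> ?H"
    if "\<bar>x - y\<bar> \<le> \<delta>" for x y
  proof -
    let ?x = "clip ?a ?b x" and ?y = "clip ?a ?b y"
    have ab: "?a \<le> ?x" "?x \<le> ?b" "?a \<le> ?y" "?y \<le> ?b" using dyad_Suc_less[of q k] by auto
    have "\<bar>?x - ?y\<bar> \<le> \<delta>" using that by (auto simp: max_def min_def)
    have "\<bar>takagi \<gamma> (?L * ?x) - takagi \<gamma> (?L * ?y)\<bar> \<le> inv_sq_sum * \<bar>?L * ?x - ?L * ?y\<bar> powr \<gamma>"
      by (rule takagi_holder[OF assms(2,3)])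
    also have "\<dots> \<le> inv_sq_sum * (?L * \<delta>) powr \<gamma>"
      using \<open>\<bar>?x - ?y\<bar> \<le> \<delta>\<close> assms(2)
      by (intro mult_left_mono powr_mono2 inv_sq_sum_nonneg) (auto simp: abs_mult simp flip: right_diff_distrib)
    finally have 1: "\<bar>takagi \<gamma> (?L * ?x) - takagi \<gamma> (?L * ?y)\<bar> \<le> inv_sq_sum * (?L * \<delta>) powr \<gamma>" .
    have 2: "\<bar>2 * apply_bcontfun v (dyad_mid q k)\<bar> \<le> 2 * norm v"
      using norm_bounded[of v "dyad_mid q k"] by simp
    have "\<bar>apply_bcontfun v ?x - apply_bcontfun v ?y\<bar>
      = \<bar>2 * apply_bcontfun v (dyad_mid q k)\<bar> * \<bar>takagi \<gamma> (?L * ?x) - takagi \<gamma> (?L * ?y)\<bar>"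
      unfolding block_space_block[OF v ab(1,2)] block_space_block[OF v ab(3,4)] right_diff_distrib[symmetric] abs_mult ..
    also have "\<dots> \<le> ?H" by (rule mult_mono[OF 2 1]) auto
    finally show ?thesis .
  qed
  have "osc_sum (\<lambda>x. apply_bcontfun v (clip ?a ?b x)) \<delta> \<le> ((?b - ?a) / \<delta> + 2) * ?H"
    using dyad_Suc_less[of q k] inv_sq_sum_nonneg
    by (intro osc_sum_le_local[OF \<delta>(1) _ _ _ H]) auto
  also have "\<dots> \<le> (3 * (1 / (?L * \<delta>))) * ?H"
  proof (rule mult_right_mono)
    have "1 \<le> 1 / (?L * \<delta>)" using \<delta> by (simp add: field_simps)
    then show "(?b - ?a) / \<delta> + 2 \<le> 3 * (1 / (?L * \<delta>))" unfolding dyad_diff by simp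
  qed (use inv_sq_sum_nonneg in simp)
  also have "\<dots> = 6 * norm v * inv_sq_sum * ((?L * \<delta>) powr \<gamma> / (?L * \<delta>))" by simp
  also have "(?L * \<delta>) powr \<gamma> / (?L * \<delta>) = (?L * \<delta>) powr (\<gamma> - 1)"
    using \<delta> by (simp add: powr_diff)
  also have "6 * norm v * inv_sq_sum * (?L * \<delta>) powr (\<gamma> - 1) \<le> 6 * norm v * inv_sq_sum * \<delta> powr (\<gamma> - 1)"
  proof (intro mult_left_mono powr_mono2')
    have "1 * \<delta> \<le> ?L * \<delta>" using \<delta> by (intro mult_right_mono one_le_power) auto
    then show "\<delta> \<le> ?L * \<delta>" by simp
  qed (use \<delta> assms(3) inv_sq_sum_nonneg in auto)
  finally show ?thesis .
qed

text \<open>Blocks are peeled off from the right. Since v vanishes at every endpoint, cutting there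
  splits v into a sum of its clipped pieces without a correction term.\<close>

lemma osc_sum_block_decomp:
  assumes v: "v \<in> block_space \<gamma> q" and \<delta>: "0 < \<delta>"
  shows "osc_sum (apply_bcontfun v) \<delta>
    \<le> osc_sum (\<lambda>x. apply_bcontfun v (clip (1 / 2 ^ q) (dyad q K) x)) \<delta>
     + (\<Sum>k<K. osc_sum (\<lambda>x. apply_bcontfun v (clip (dyad q (Suc k)) (dyad q k) x)) \<delta>)"
proof (induction K)
  case 0
  have "apply_bcontfun v (clip (1 / 2 ^ q) (dyad q 0) x) = apply_bcontfun v x" for x
  proof -
    consider "x \<le> 1 / 2 ^ q" | "dyad q 0 \<le> x" | "1 / 2 ^ q \<le> x" "x \<le> dyad q 0" by linarith
    then show ?thesis
    proof cases
      case 1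
      then have "clip (1 / 2 ^ q) (dyad q 0) x = 1 / 2 ^ q" by simp
      then show ?thesis using 1 block_space_outside[OF v] by simp
    next
      case 2
      then have "clip (1 / 2 ^ q) (dyad q 0) x = dyad q 0" using dyad_gt[of q 0] by simp
      then show ?thesis using 2 block_space_outside[OF v] by (simp add: dyad_0)
    qed simp
  qed
  then show ?case by simp
next
  case (Suc K)
  have cont: "continuous_on UNIV (\<lambda>x. apply_bcontfun v (clip a b x))" for a b
    by (rule continuous_on_compose2[of UNIV]) (auto intro!: continuous_intros)
  have "apply_bcontfun v (clip (1 / 2 ^ q) (dyad q K) x)
    = apply_bcontfun v (clip (1 / 2 ^ q) (dyad q (Suc K)) x) + apply_bcontfun v (clip (dyad q (Suc K)) (dyad q K) x)" for x
  proof (cases "x \<le> dyad q (Suc K)")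
    case True
    then have "clip (dyad q (Suc K)) (dyad q K) x = dyad q (Suc K)"
      "clip (1 / 2 ^ q) (dyad q K) x = clip (1 / 2 ^ q) (dyad q (Suc K)) x"
      using dyad_Suc_less[of q K] by auto
    then show ?thesis using block_space_dyad[OF v] by simp
  next
    case False
    then have "clip (1 / 2 ^ q) (dyad q (Suc K)) x = dyad q (Suc K)"
      "clip (1 / 2 ^ q) (dyad q K) x = clip (dyad q (Suc K)) (dyad q K) x"
      using dyad_Suc_less[of q K] dyad_gt[of q "Suc K"] by auto
    then show ?thesis using block_space_dyad[OF v] by simp
  qed
  then have "osc_sum (\<lambda>x. apply_bcontfun v (clip (1 / 2 ^ q) (dyad q K) x)) \<delta>
    \<le> osc_sum (\<lambda>x. apply_bcontfun v (clip (1 / 2 ^ q) (dyad q (Suc K)) x)) \<delta>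
     + osc_sum (\<lambda>x. apply_bcontfun v (clip (dyad q (Suc K)) (dyad q K) x)) \<delta>"
    using osc_sum_add_le[OF cont cont \<delta>] by simp
  with Suc show ?case by simp
qed

text \<open>The tail has length at most 2 * \<delta>, so at most 4 columns meet it, and each
  oscillates by at most 2 * norm v.\<close>

lemma osc_sum_tail_le:
  assumes "0 < \<delta>" "1 / 2 ^ (q + K) \<le> 2 * \<delta>"
  shows "osc_sum (\<lambda>x. apply_bcontfun v (clip (1 / 2 ^ q) (dyad q K) x)) \<delta> \<le> 8 * norm v"
proof -
  have bound: "\<bar>apply_bcontfun v a - apply_bcontfun v b\<bar> \<le> 2 * norm v" for a b
    using norm_bounded[of v a] norm_bounded[of v b] unfolding real_norm_def by linarith
  have "osc_sum (\<lambda>x. apply_bcontfun v (clip (1 / 2 ^ q) (dyad q K) x)) \<delta>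
    \<le> ((dyad q K - 1 / 2 ^ q) / \<delta> + 2) * (2 * norm v)"
  proof (rule osc_sum_le_local)
    fix x y
    show "\<bar>apply_bcontfun v (clip (1 / 2 ^ q) (dyad q K) x) - apply_bcontfun v (clip (1 / 2 ^ q) (dyad q K) y)\<bar> \<le> 2 * norm v"
      by (rule bound)
  qed (use dyad_gt[of q K] assms in auto)
  also have "dyad q K - 1 / 2 ^ q = 1 / 2 ^ (q + K)"
    by (simp add: dyad_def power_add field_simps)
  also have "(1 / 2 ^ (q + K) / \<delta> + 2) * (2 * norm v) \<le> (2 + 2) * (2 * norm v)"
    using assms by (intro mult_right_mono add_mono) (auto simp: field_simps)
  finally show ?thesis by simp
qed

text \<open>Blocks no shorter than \<delta> number at most log 2 (1 / \<delta>) and contribute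
  O(\<delta>^(1-s)) each; all shorter blocks together form the tail. Every u > s absorbs the
  logarithm.\<close>

lemma osc_growth_block_space:
  assumes v: "v \<in> block_space (2 - s) q" and s: "1 < s" "s \<le> 2"
  shows "osc_growth s (apply_bcontfun v)"
proof (rule osc_growthI)
  fix u assume "u > s"
  let ?C = "max (8 * norm v) (6 * norm v * inv_sq_sum)"
  have bound: "osc_sum (apply_bcontfun v) \<delta> \<le> (log 2 (1 / \<delta>) + 1) * (?C * \<delta> powr (1 - s))"
    if \<delta>: "0 < \<delta>" "\<delta> < 1" for \<delta>
  proof -
    define n where "n = nat \<lfloor>log 2 (1 / \<delta>)\<rfloor>"
    have "0 < log 2 (1 / \<delta>)" using \<delta> by simp
    then have n: "real n \<le> log 2 (1 / \<delta>)" "log 2 (1 / \<delta>) < real n + 1"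
      unfolding n_def by (auto simp: of_nat_nat)
    have "2 ^ n \<le> 1 / \<delta>" using n(1) \<delta> by (simp add: le_log_iff powr_realpow)
    then have n1: "\<delta> \<le> 1 / 2 ^ n" using \<delta> by (simp add: field_simps)
    have "1 / \<delta> < 2 ^ (n + 1)" using n(2) \<delta> by (simp add: log_less_iff powr_add powr_realpow)
    then have n2: "1 / 2 ^ n \<le> 2 * \<delta>" using \<delta> by (simp add: field_simps)
    \<comment> \<open>Here 2^-n is comparable to \<delta>, and the blocks k < K are exactly those of
      length at least 2^-n. If n < q, truncated subtraction gives K = 0 and the whole function
      counts as tail.\<close>
    define K where "K = n - q"
    have 1: "1 \<le> \<delta> powr (1 - s)"
      using powr_mono'[of "1 - s" 0 \<delta>] \<delta> s by simp
    have half: "1 / 2 ^ b \<le> (1 / 2 ^ a :: real)" if "a \<le> b" for a b :: nat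
      using that by (simp add: field_simps power_increasing)
    have "1 / 2 ^ (q + K) \<le> (1 / 2 ^ n :: real)" by (rule half) (simp add: K_def)
    then have "osc_sum (\<lambda>x. apply_bcontfun v (clip (1 / 2 ^ q) (dyad q K) x)) \<delta> \<le> 8 * norm v"
      using n2 \<delta> by (intro osc_sum_tail_le) auto
    also have "\<dots> \<le> ?C * \<delta> powr (1 - s)"
    proof -
      have "8 * norm v * 1 \<le> ?C * \<delta> powr (1 - s)"
        using 1 by (intro mult_mono) (auto intro: max.coboundedI1)
      then show ?thesis by simp
    qed
    finally have tail: "osc_sum (\<lambda>x. apply_bcontfun v (clip (1 / 2 ^ q) (dyad q K) x)) \<delta> \<le> ?C * \<delta> powr (1 - s)" .
    have blk: "osc_sum (\<lambda>x. apply_bcontfun v (clip (dyad q (Suc k)) (dyad q k) x)) \<delta> \<le> ?C * \<delta> powr (1 - s)"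
      if "k < K" for k
    proof -
      have "1 / 2 ^ n \<le> (1 / 2 ^ (q + k + 1) :: real)" using that by (intro half) (simp add: K_def)
      with osc_sum_block_le[OF v _ _ \<delta>(1), of k] n1 s
      have "osc_sum (\<lambda>x. apply_bcontfun v (clip (dyad q (Suc k)) (dyad q k) x)) \<delta>
        \<le> 6 * norm v * inv_sq_sum * \<delta> powr (1 - s)" by simp
      also have "\<dots> \<le> ?C * \<delta> powr (1 - s)" by (intro mult_right_mono) auto
      finally show ?thesis .
    qed
    have "osc_sum (apply_bcontfun v) \<delta> \<le> ?C * \<delta> powr (1 - s) + (\<Sum>k<K. ?C * \<delta> powr (1 - s))"
      by (intro order.trans[OF osc_sum_block_decomp[OF v \<delta>(1), of K]] add_mono sum_mono tail blk) auto
    also have "\<dots> = (real K + 1) * (?C * \<delta> powr (1 - s))" by (simp add: algebra_simps)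
    also have "\<dots> \<le> (log 2 (1 / \<delta>) + 1) * (?C * \<delta> powr (1 - s))"
    proof (rule mult_right_mono)
      have "real K \<le> real n" by (simp add: K_def)
      then show "real K + 1 \<le> log 2 (1 / \<delta>) + 1" using n(1) by simp
      have "0 \<le> 8 * norm v" by simp
      then have "0 \<le> ?C" by (rule max.coboundedI1)
      then show "0 \<le> ?C * \<delta> powr (1 - s)" by simp
    qed
    finally show ?thesis .
  qed
  have "\<forall>\<^sub>F \<delta> in at_right 0. log 2 (1 / \<delta>) + 1 \<le> \<delta> powr (s - u)"
    using \<open>u > s\<close> by real_asymp
  moreover have "\<forall>\<^sub>F \<delta>::real in at_right 0. \<delta> < 1"
    by (auto simp: eventually_at_right_field intro!: exI[of _ 1])
  moreover note eventually_at_right_less[of 0]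
  ultimately have "\<forall>\<^sub>F \<delta> in at_right 0. osc_sum (apply_bcontfun v) \<delta> \<le> ?C * \<delta> powr (1 - u)"
  proof eventually_elim
    case (elim \<delta>)
    have "0 \<le> 8 * norm v" by simp
    then have C0: "0 \<le> ?C" by (rule max.coboundedI1)
    have "osc_sum (apply_bcontfun v) \<delta> \<le> (log 2 (1 / \<delta>) + 1) * (?C * \<delta> powr (1 - s))"
      using elim by (intro bound) auto
    also have "\<dots> \<le> \<delta> powr (s - u) * (?C * \<delta> powr (1 - s))"
      using elim C0 by (intro mult_right_mono) auto
    also have "\<dots> = ?C * (\<delta> powr (s - u) * \<delta> powr (1 - s))" by simp
    also have "\<delta> powr (s - u) * \<delta> powr (1 - s) = \<delta> powr (1 - u)" by (simp flip: powr_add)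
    finally show ?case .
  qed
  then show "\<exists>C. \<forall>\<^sub>F \<delta> in at_right 0. osc_sum (apply_bcontfun v) \<delta> \<le> C * \<delta> powr (1 - u)" by blast
qed

text \<open>The given indices are those of the columns inside block k. On each, the second
  difference at level m equals the scalar times the m-th coefficient, and a midpoint value deviates
  from the mean of the end values by at most the oscillation.\<close>

lemma osc_block_ge:
  fixes i :: nat
  assumes v: "v \<in> block_space \<gamma> q" and "0 \<le> \<gamma>"
    and i: "2 ^ m * (2 ^ (k + 1) + 1) \<le> i" "i < 2 ^ m * (2 ^ (k + 1) + 2)"
  shows "\<bar>apply_bcontfun v (dyad_mid q k)\<bar> * takagi_coeff \<gamma> m
    \<le> osc (apply_bcontfun v) (1 / 2 ^ (m + (q + k + 1))) i"
proof -
  let ?L = "2 ^ (q + k + 1) :: real" and ?\<delta> = "1 / 2 ^ (m + (q + k + 1)) :: real"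
  let ?l = "real i * ?\<delta>" and ?r = "(real i + 1) * ?\<delta>" and ?c = "(2 * real i + 1) / 2 * ?\<delta>"
  let ?c2 = "2 * apply_bcontfun v (dyad_mid q k)"
  have scaled: "?L * ?l = of_int (int i) / 2 ^ m" "?L * ?r = (of_int (int i) + 1) / 2 ^ m"
      "?L * ?c = (2 * of_int (int i) + 1) / 2 ^ (m + 1)"
    by (simp_all add: power_add field_simps)
  have lcr: "?l \<le> ?c" "?c \<le> ?r" by (simp_all add: field_simps)
  have "real (2 ^ m * (2 ^ (k + 1) + 1)) \<le> real i" using i(1) by (simp only: of_nat_le_iff)
  then have "?L * dyad q (Suc k) \<le> ?L * ?l"
    unfolding dyad_scaled scaled by (simp add: field_simps)
  then have l: "dyad q (Suc k) \<le> ?l" by (subst (asm) mult_le_cancel_left_pos) auto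
  have "real (i + 1) \<le> real (2 ^ m * (2 ^ (k + 1) + 2))" using i(2) by (simp only: of_nat_le_iff)
  then have "?L * ?r \<le> ?L * dyad q k"
    unfolding dyad_scaled scaled by (simp add: field_simps)
  then have r: "?r \<le> dyad q k" by (subst (asm) mult_le_cancel_left_pos) auto
  have val: "apply_bcontfun v x = ?c2 * takagi \<gamma> (?L * x)" if "?l \<le> x" "x \<le> ?r" for x
    using block_space_block[OF v, of k x] l r that by linarith
  have "apply_bcontfun v ?c - (apply_bcontfun v ?l + apply_bcontfun v ?r) / 2
    = ?c2 * (takagi \<gamma> (?L * ?c) - (takagi \<gamma> (?L * ?l) + takagi \<gamma> (?L * ?r)) / 2)"
    using lcr by (subst (1 2 3) val) (auto simp: algebra_simps)
  also have "\<dots> = ?c2 * (takagi_coeff \<gamma> m / 2)"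
    unfolding scaled by (subst takagi_second_difference[OF assms(2)]) simp
  finally have "\<bar>apply_bcontfun v (dyad_mid q k)\<bar> * takagi_coeff \<gamma> m
    = \<bar>apply_bcontfun v ?c - (apply_bcontfun v ?l + apply_bcontfun v ?r) / 2\<bar>"
    using takagi_coeff_pos[of \<gamma> m] by (simp add: abs_mult)
  also have "\<dots> \<le> osc (apply_bcontfun v) ?\<delta> i"
  proof -
    have "\<bar>apply_bcontfun v ?c - apply_bcontfun v ?l\<bar> \<le> osc (apply_bcontfun v) ?\<delta> i"
      "\<bar>apply_bcontfun v ?c - apply_bcontfun v ?r\<bar> \<le> osc (apply_bcontfun v) ?\<delta> i"
      using lcr by (auto intro!: abs_diff_le_osc simp del: of_nat_Suc)
    moreover have "\<bar>c - (l + r) / 2\<bar> \<le> H" if "\<bar>c - l\<bar> \<le> H" "\<bar>c - r\<bar> \<le> H" for c l r H :: real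
      using that by (simp add: abs_le_iff field_simps)
    ultimately show ?thesis by blast
  qed
  finally show ?thesis .
qed

lemma osc_sum_block_ge:
  assumes v: "v \<in> block_space \<gamma> q" and "0 \<le> \<gamma>" "1 \<le> q"
  shows "2 ^ m * (\<bar>apply_bcontfun v (dyad_mid q k)\<bar> * takagi_coeff \<gamma> m)
    \<le> osc_sum (apply_bcontfun v) (1 / 2 ^ (m + (q + k + 1)))"
proof -
  let ?\<delta> = "1 / 2 ^ (m + (q + k + 1)) :: real"
  let ?I = "{2 ^ m * (2 ^ (k + 1) + 1)..<2 ^ m * (2 ^ (k + 1) + 2) :: nat}"
  let ?c = "\<bar>apply_bcontfun v (dyad_mid q k)\<bar> * takagi_coeff \<gamma> m"
  \<comment> \<open>The assumption 1 \<le> q places the block inside [0, 1], so its 2^m columns are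
    among those that \<open>osc_sum\<close> counts.\<close>
  have "2 ^ m * (2 ^ (k + 1) + 2) \<le> (2 ^ m * 2 ^ (k + 2) :: nat)" by simp
  also have "\<dots> = 2 ^ (m + k + 2)" by (simp add: power_add)
  also have "\<dots> \<le> 2 ^ (m + (q + k + 1))" using \<open>1 \<le> q\<close> by (intro power_increasing) auto
  finally have "?I \<subseteq> {..2 ^ (m + (q + k + 1))}" by auto
  moreover have "nat \<lfloor>1 / ?\<delta>\<rfloor> = 2 ^ (m + (q + k + 1))"
  proof -
    have "1 / ?\<delta> = of_int (2 ^ (m + (q + k + 1)))" by simp
    then have "\<lfloor>1 / ?\<delta>\<rfloor> = 2 ^ (m + (q + k + 1))" by (simp only: floor_of_int)
    then have "nat \<lfloor>1 / ?\<delta>\<rfloor> = nat (int (2 ^ (m + (q + k + 1))))" by simp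
    then show ?thesis by (simp only: nat_int)
  qed
  ultimately have sub: "?I \<subseteq> {..nat \<lfloor>1 / ?\<delta>\<rfloor>}" by simp
  have "card ?I = 2 ^ m" by (simp flip: diff_mult_distrib2)
  then have "2 ^ m * ?c = (\<Sum>i\<in>?I. ?c)" by simp
  also have "\<dots> \<le> (\<Sum>i\<in>?I. osc (apply_bcontfun v) ?\<delta> i)"
    by (intro sum_mono osc_block_ge[OF v \<open>0 \<le> \<gamma>\<close>]) auto
  also have "\<dots> \<le> osc_sum (apply_bcontfun v) ?\<delta>"
    unfolding osc_sum_def using sub by (intro sum_mono2 osc_nonneg) auto
  finally show ?thesis .
qed

lemma block_space_nonzero_mid:
  assumes v: "v \<in> block_space \<gamma> q" "v \<noteq> 0"
  obtains k where "apply_bcontfun v (dyad_mid q k) \<noteq> 0"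
proof -
  obtain x where x: "apply_bcontfun v x \<noteq> 0"
    using v(2) by (metis bcontfun_eqI zero_bcontfun.rep_eq)
  then have x1: "1 / 2 ^ q < x" "x < dyad q 0"
    using block_space_outside[OF v(1), of x] unfolding dyad_0 by force+
  have "(\<lambda>k. dyad q k) \<longlonglongrightarrow> (1 + 0) / 2 ^ q"
    unfolding dyad_def by (intro tendsto_intros LIMSEQ_divide_realpow_zero) auto
  then have "\<forall>\<^sub>F k in sequentially. dyad q k < x" using x1 by (intro order_tendstoD) auto
  then obtain N where "dyad q N < x" by (auto simp: eventually_sequentially)
  \<comment> \<open>The first endpoint to the left of x; it is not endpoint 0, so x lies in the
    block between it and its predecessor.\<close>
  define K where "K = (LEAST k. dyad q k < x)"
  have K: "dyad q K < x" unfolding K_def using \<open>dyad q N < x\<close> by (rule LeastI)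
  have "K \<noteq> 0"
  proof
    assume "K = 0"
    with K x1(2) show False by simp
  qed
  then obtain k where k: "K = Suc k" using not0_implies_Suc by blast
  have "\<not> dyad q k < x" unfolding K_def using k K_def by (intro not_less_Least) simp
  with K k block_space_block[OF v(1), of k x] x have "apply_bcontfun v (dyad_mid q k) \<noteq> 0" by auto
  with that show ?thesis .
qed

text \<open>One nonzero block suffices. At \<delta> = 2^-(m+Q) its columns contribute c * 2^(m
  (s-1)) / (m+1)^2, which for u < s eventually exceeds \<delta>^(1-u) = 2^((m+Q) (u-1)).\<close>

lemma not_osc_growth_block_space:
  assumes v: "v \<in> block_space (2 - s) q" "v \<noteq> 0" and "s \<le> 2" "1 \<le> q" "t < s"
  shows "\<not> osc_growth t (apply_bcontfun v)"
proof
  assume gr: "osc_growth t (apply_bcontfun v)"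
  obtain k where k: "apply_bcontfun v (dyad_mid q k) \<noteq> 0"
    using block_space_nonzero_mid[OF v] .
  define c where "c = \<bar>apply_bcontfun v (dyad_mid q k)\<bar>"
  have "0 < c" using k by (simp add: c_def)
  define u where "u = (t + s) / 2"
  have u: "t < u" "u < s" using \<open>t < s\<close> by (auto simp: u_def)
  define Q where "Q = q + k + 1"
  have "filterlim (\<lambda>m. 1 / 2 ^ (m + Q) :: real) (at_right 0) sequentially"
    by real_asymp
  moreover have "\<forall>\<^sub>F \<delta> in at_right 0. osc_sum (apply_bcontfun v) \<delta> \<le> \<delta> powr (1 - u)"
    using gr u by (simp add: osc_growth_def)
  ultimately have "\<forall>\<^sub>F m in sequentially. osc_sum (apply_bcontfun v) (1 / 2 ^ (m + Q)) \<le> (1 / 2 ^ (m + Q)) powr (1 - u)"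
    by (rule eventually_compose_filterlim[rotated])
  moreover have "filterlim (\<lambda>m. 2 powr (real m * (s - u)) / (real m + 1)\<^sup>2) at_top sequentially"
    using u by real_asymp
  then have "\<forall>\<^sub>F m in sequentially. 2 powr (real m * (s - u)) / (real m + 1)\<^sup>2 > 2 powr (real Q * (u - 1)) / c"
    by (simp add: filterlim_at_top_dense)
  ultimately have "\<forall>\<^sub>F m :: nat in sequentially. False"
  proof eventually_elim
    case (elim m)
    have "2 ^ m * (c * takagi_coeff (2 - s) m) \<le> (1 / 2 ^ (m + Q)) powr (1 - u)"
      using osc_sum_block_ge[OF v(1) _ \<open>1 \<le> q\<close>, of m k] \<open>s \<le> 2\<close> elim by (simp add: c_def Q_def)
    also have "(1 / 2 ^ (m + Q)) powr (1 - u) = (2 powr (- real (m + Q))) powr (1 - u)"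
      by (simp add: powr_minus powr_realpow divide_inverse del: of_nat_add)
    also have "\<dots> = 2 powr (real m * (u - 1)) * 2 powr (real Q * (u - 1))"
      unfolding powr_powr powr_add[symmetric] by (simp add: algebra_simps)
    finally have 1: "2 ^ m * (c * takagi_coeff (2 - s) m) \<le> 2 powr (real m * (u - 1)) * 2 powr (real Q * (u - 1))" .
    have "2 powr (real m * (u - 1)) * 2 powr (real Q * (u - 1))
      < 2 powr (real m * (u - 1)) * (c * (2 powr (real m * (s - u)) / (real m + 1)\<^sup>2))"
      using elim(2) \<open>0 < c\<close> by (intro mult_strict_left_mono) (auto simp: pos_divide_less_eq mult.commute)
    also have "\<dots> = c * ((2 powr (real m * (u - 1)) * 2 powr (real m * (s - u))) / (real m + 1)\<^sup>2)" by simp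
    also have "2 powr (real m * (u - 1)) * 2 powr (real m * (s - u)) = 2 powr real m * 2 powr (- (2 - s) * real m)"
      unfolding powr_add[symmetric] by (simp add: algebra_simps)
    also have "c * (2 powr real m * 2 powr (- (2 - s) * real m) / (real m + 1)\<^sup>2) = 2 ^ m * (c * takagi_coeff (2 - s) m)"
      by (simp add: takagi_coeff_def powr_realpow)
    finally show False using 1 by simp
  qed
  then show False by simp
qed

section \<open>Continuum many independent block functions\<close>

lemma power_sums_zero_imp_coeff_zero:
  fixes a :: "real \<Rightarrow> real"
  assumes "finite T" "\<And>k. (\<Sum>t\<in>T. a t * t ^ k) = 0" "t \<in> T"
  shows "a t = 0"
proof -
  have poly0: "(\<Sum>t\<in>T. a t * poly p t) = 0" for p
  proof -
    have "(\<Sum>t\<in>T. a t * poly p t) = (\<Sum>t\<in>T. \<Sum>i\<le>degree p. coeff p i * (a t * t ^ i))"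
      unfolding poly_altdef sum_distrib_left by (intro sum.cong refl) simp
    also have "\<dots> = (\<Sum>i\<le>degree p. coeff p i * (\<Sum>t\<in>T. a t * t ^ i))"
      unfolding sum_distrib_left by (rule sum.swap)
    finally show ?thesis using assms(2) by simp
  qed
  \<comment> \<open>A Vandermonde argument: the weighted sums vanish on all polynomials, and this
    one vanishes on \<open>T\<close> except at \<open>t\<close>, so it isolates the coefficient
    there.\<close>
  let ?p = "\<Prod>r\<in>T - {t}. [:- r, 1:]"
  have "0 = a t * poly ?p t + (\<Sum>r\<in>T - {t}. a r * poly ?p r)"
    using poly0[of ?p] sum.remove[OF assms(1,3), of "\<lambda>t. a t * poly ?p t"] by simp
  also have "(\<Sum>r\<in>T - {t}. a r * poly ?p r) = 0"
    using assms(1) by (intro sum.neutral) (auto simp: poly_prod prod_zero_iff)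
  finally have "a t * poly ?p t = 0" by simp
  moreover have "poly ?p t \<noteq> 0" using assms(1) by (auto simp: poly_prod prod_zero_iff)
  ultimately show ?thesis by simp
qed

text \<open>Outside block k the clip freezes the argument at an endpoint, where the rescaled
  function is 0; this gives the basic element carried by a single block.\<close>

definition bump :: "real \<Rightarrow> nat \<Rightarrow> nat \<Rightarrow> real \<Rightarrow>\<^sub>C real" where
  "bump \<gamma> q k = Bcontfun (\<lambda>x. takagi \<gamma> (2 ^ (q + k + 1) * clip (dyad q (Suc k)) (dyad q k) x))"

lemma bump_apply:
  assumes "0 \<le> \<gamma>"
  shows "apply_bcontfun (bump \<gamma> q k) x = takagi \<gamma> (2 ^ (q + k + 1) * clip (dyad q (Suc k)) (dyad q k) x)"
proof -
  have "continuous_on UNIV (\<lambda>x. takagi \<gamma> (2 ^ (q + k + 1) * clip (dyad q (Suc k)) (dyad q k) x))"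
    by (rule continuous_on_compose2[OF continuous_on_takagi[OF assms]]) (auto intro!: continuous_intros)
  then have "apply_bcontfun (bump \<gamma> q k) = (\<lambda>x. takagi \<gamma> (2 ^ (q + k + 1) * clip (dyad q (Suc k)) (dyad q k) x))"
    unfolding bump_def by (rule apply_bcontfun_Bcontfun) (use takagi_abs_le[OF assms] in auto)
  then show ?thesis by simp
qed

lemma bump_outside:
  assumes "0 \<le> \<gamma>" "x \<le> dyad q (Suc k) \<or> dyad q k \<le> x"
  shows "apply_bcontfun (bump \<gamma> q k) x = 0"
proof -
  from assms(2) have "clip (dyad q (Suc k)) (dyad q k) x = dyad q (Suc k) \<or> clip (dyad q (Suc k)) (dyad q k) x = dyad q k"
    using dyad_Suc_less[of q k] by auto
  then show ?thesis
    unfolding bump_apply[OF assms(1)] by (elim disjE) (simp_all only: dyad_scaled takagi_of_int)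
qed

lemma bump_mid:
  assumes "0 \<le> \<gamma>"
  shows "apply_bcontfun (bump \<gamma> q k) (dyad_mid q j) = (if j = k then 1 / 2 else 0)"
proof -
  consider "j = k" | "j < k" | "k < j" by linarith
  then show ?thesis
  proof cases
    case 1
    have "clip (dyad q (Suc k)) (dyad q k) (dyad_mid q k) = dyad_mid q k"
      using dyad_mid_bounds[of q k] by auto
    then show ?thesis using 1 unfolding bump_apply[OF assms] by (simp only: dyad_scaled takagi_half[OF assms]) simp
  next
    case 2
    then show ?thesis using dyad_antimono[of "Suc j" k q] dyad_mid_bounds[of q j]
      by (subst bump_outside[OF assms]) auto
  next
    case 3
    then show ?thesis using dyad_antimono[of "Suc k" j q] dyad_mid_bounds[of q j]
      by (subst bump_outside[OF assms]) auto
  qed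
qed

lemma bump_in_block_space:
  assumes "0 \<le> \<gamma>"
  shows "bump \<gamma> q k \<in> block_space \<gamma> q"
proof -
  have "apply_bcontfun (bump \<gamma> q k) x = 0" if "x \<le> 1 / 2 ^ q \<or> 2 / 2 ^ q \<le> x" for x
    using that dyad_gt[of q "Suc k"] dyad_antimono[of 0 k q]
    by (intro bump_outside[OF assms]) (auto simp: dyad_0)
  moreover have "apply_bcontfun (bump \<gamma> q k) x =
        2 * apply_bcontfun (bump \<gamma> q k) (dyad_mid q j) * takagi \<gamma> (2 ^ (q + j + 1) * x)"
    if x: "x \<in> {dyad q (Suc j)..dyad q j}" for x j
  proof -
    consider "j = k" | "j < k" | "k < j" by linarith
    then show ?thesis
    proof cases
      case 1
      then show ?thesis unfolding bump_mid[OF assms] bump_apply[OF assms, of q k x] using x by simp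
    next
      case 2
      then show ?thesis unfolding bump_mid[OF assms] using dyad_antimono[of "Suc j" k q] x
        by (subst bump_outside[OF assms]) auto
    next
      case 3
      then show ?thesis unfolding bump_mid[OF assms] using dyad_antimono[of "Suc k" j q] x
        by (subst bump_outside[OF assms]) auto
    qed
  qed
  ultimately show ?thesis unfolding block_space_def by blast
qed

text \<open>Joins the norm and completeness, so that the comparison test applies to series of
  bounded continuous functions.\<close>

instance bcontfun :: (metric_space, banach) banach ..

text \<open>The block scalars are geometric sequences with ratio t in (0, 1). They converge in norm,
  midpoint values recover the powers of t, and distinct ratios give independent sequences.\<close>

lemma block_space_independent_continuum:
  assumes "0 \<le> \<gamma>"
  obtains E where "E \<subseteq> block_space \<gamma> q" "independent E" "E \<approx> (UNIV :: real set)"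
proof -
  define w where "w t = (\<Sum>k. t ^ k *\<^sub>R bump \<gamma> q k)" for t :: real
  have summable: "summable (\<lambda>k. t ^ k *\<^sub>R bump \<gamma> q k)" if t: "t \<in> {0<..<1}" for t
  proof (rule summable_comparison_test[where g = "\<lambda>k. t ^ k * inv_sq_sum"])
    have "norm (bump \<gamma> q k) \<le> inv_sq_sum" for k
      using takagi_abs_le[OF assms] by (intro norm_bound) (simp add: bump_apply[OF assms])
    then have "norm (t ^ k *\<^sub>R bump \<gamma> q k) \<le> t ^ k * inv_sq_sum" for k
      using t by (simp add: mult_left_mono)
    then show "\<exists>N. \<forall>k\<ge>N. norm (t ^ k *\<^sub>R bump \<gamma> q k) \<le> t ^ k * inv_sq_sum" by blast
    show "summable (\<lambda>k. t ^ k * inv_sq_sum)" using t by (intro summable_mult2 summable_geometric) auto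
  qed
  have w_mem: "w t \<in> block_space \<gamma> q" if t: "t \<in> {0<..<1}" for t
  proof (rule closed_sequentially[OF closed_block_space])
    show "(\<lambda>n. \<Sum>k<n. t ^ k *\<^sub>R bump \<gamma> q k) \<longlonglongrightarrow> w t"
      unfolding w_def by (rule summable_LIMSEQ[OF summable[OF t]])
    show "(\<Sum>k<n. t ^ k *\<^sub>R bump \<gamma> q k) \<in> block_space \<gamma> q" for n
      by (intro subspace_sum subspace_scale subspace_block_space bump_in_block_space assms)
  qed
  have w_mid: "apply_bcontfun (w t) (dyad_mid q j) = t ^ j / 2" if t: "t \<in> {0<..<1}" for t j
  proof -
    have "(\<lambda>k. apply_bcontfun (t ^ k *\<^sub>R bump \<gamma> q k) (dyad_mid q j)) sums apply_bcontfun (w t) (dyad_mid q j)"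
      unfolding w_def by (intro bounded_linear.sums[OF bounded_linear_apply_bcontfun] summable_sums summable t)
    moreover have "(\<lambda>k. apply_bcontfun (t ^ k *\<^sub>R bump \<gamma> q k) (dyad_mid q j)) = (\<lambda>k. if k = j then t ^ k / 2 else 0)"
      by (auto simp: bump_mid[OF assms])
    ultimately show ?thesis using sums_unique2[OF _ sums_single[of j "\<lambda>k. t ^ k / 2"]] by metis
  qed
  have inj: "inj_on w {0<..<1}"
  proof (rule inj_onI)
    fix t r assume "t \<in> {0<..<1}" "r \<in> {0<..<1}" "w t = w r"
    then show "t = r" using w_mid[of t 1] w_mid[of r 1] by simp
  qed
  show ?thesis
  proof (rule that[of "w ` {0<..<1}"])
    show "w ` {0<..<1} \<subseteq> block_space \<gamma> q" using w_mem by blast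
    have "w ` {0<..<1} \<approx> {0<..<1::real}" using inj by (rule inj_on_image_eqpoll_self)
    then show "w ` {0<..<1} \<approx> (UNIV :: real set)"
      using open_interval_eqpoll_reals[of 0 1] eqpoll_trans by auto
    show "independent (w ` {0<..<1})"
      unfolding independent_explicit_module
    proof (intro allI impI)
      fix S c x assume S: "finite S" "S \<subseteq> w ` {0<..<1}" "(\<Sum>v\<in>S. c v *\<^sub>R v) = 0" "x \<in> S"
      obtain T where T: "T \<subseteq> {0<..<1}" "S = w ` T" using S(2) by (meson subset_imageE)
      have inj': "inj_on w T" using inj T(1) by (rule inj_on_subset)
      have finT: "finite T" using S(1) T(2) inj' finite_imageD by blast
      have "(\<Sum>t\<in>T. c (w t) * t ^ k) = 0" for k
      proof -
        have "0 = apply_bcontfun (\<Sum>t\<in>T. c (w t) *\<^sub>R w t) (dyad_mid q k)"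
          using S(3) unfolding T(2) by (simp add: sum.reindex[OF inj'])
        also have "\<dots> = (\<Sum>t\<in>T. apply_bcontfun (c (w t) *\<^sub>R w t) (dyad_mid q k))"
          by (rule linear_sum[OF bounded_linear.linear[OF bounded_linear_apply_bcontfun]])
        also have "\<dots> = (\<Sum>t\<in>T. c (w t) * t ^ k) / 2"
          unfolding sum_divide_distrib using T(1) by (intro sum.cong) (auto simp: w_mid)
        finally show ?thesis by simp
      qed
      then have "c (w t) = 0" if "t \<in> T" for t
        using power_sums_zero_imp_coeff_zero[OF finT, of "\<lambda>t. c (w t)"] that by blast
      with S(4) T(2) show "c x = 0" by blast
    qed
  qed
qed

section \<open>Small functions and the main argument\<close>

definition growth_space :: "real \<Rightarrow> (real \<Rightarrow>\<^sub>C real) set" where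
  "growth_space t = {f \<in> C01. osc_growth t (apply_bcontfun f)}"

definition small_space :: "real \<Rightarrow> (real \<Rightarrow>\<^sub>C real) set" where
  "small_space s = {f \<in> C01. \<exists>t<s. osc_growth t (apply_bcontfun f)}"

lemma subspace_C01: "subspace C01"
  by (rule subspaceI) (auto simp: C01_def)

text \<open>One family for the zero function, the constants and the identity: the 1 / \<delta> + 2
  columns oscillate by at most |a| * \<delta> each, so the sums stay bounded.\<close>

lemma osc_growth_affine:
  assumes "1 \<le> t"
  shows "osc_growth t (\<lambda>x. a * clip 0 1 x + c)"
proof (rule osc_growthI)
  fix u assume "t < u"
  have "\<forall>\<^sub>F \<delta>::real in at_right 0. \<delta> < 1"
    by (auto simp: eventually_at_right_field intro!: exI[of _ 1])
  with eventually_at_right_less[of 0]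
  have "\<forall>\<^sub>F \<delta> in at_right 0. osc_sum (\<lambda>x. a * clip 0 1 x + c) \<delta> \<le> (3 * \<bar>a\<bar>) * \<delta> powr (1 - u)"
  proof eventually_elim
    case (elim \<delta>)
    have "osc_sum (\<lambda>x. a * clip 0 1 x + c) \<delta> \<le> ((1 - 0) / \<delta> + 2) * (\<bar>a\<bar> * \<delta>)"
    proof (rule osc_sum_le_local)
      fix x y :: real assume "\<bar>x - y\<bar> \<le> \<delta>"
      then have "\<bar>clip 0 1 x - clip 0 1 y\<bar> \<le> \<delta>" by linarith
      then show "\<bar>a * clip 0 1 x + c - (a * clip 0 1 y + c)\<bar> \<le> \<bar>a\<bar> * \<delta>"
        by (simp add: mult_left_mono abs_mult flip: right_diff_distrib)
    qed (use elim in auto)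
    also have "\<dots> = (1 + 2 * \<delta>) * \<bar>a\<bar>" using elim by (simp add: field_simps)
    also have "\<dots> \<le> 3 * \<bar>a\<bar> * 1" using elim by (simp add: mult_right_mono)
    also have "\<dots> \<le> 3 * \<bar>a\<bar> * \<delta> powr (1 - u)"
      using powr_mono'[of "1 - u" 0 \<delta>] elim \<open>t < u\<close> assms by (intro mult_left_mono) auto
    finally show ?case .
  qed
  then show "\<exists>C. \<forall>\<^sub>F \<delta> in at_right 0. osc_sum (\<lambda>x. a * clip 0 1 x + c) \<delta> \<le> C * \<delta> powr (1 - u)" by blast
qed

lemma subspace_growth_space:
  assumes "1 \<le> t"
  shows "subspace (growth_space t)"
proof (rule subspaceI)
  show "0 \<in> growth_space t"
    using osc_growth_affine[OF assms, of 0 0] subspace_0[OF subspace_C01]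
    by (simp add: growth_space_def zero_bcontfun.rep_eq[abs_def])
  show "f + g \<in> growth_space t" if "f \<in> growth_space t" "g \<in> growth_space t" for f g
    using that osc_growth_add[of "apply_bcontfun f" "apply_bcontfun g" t] subspace_add[OF subspace_C01]
    by (auto simp: growth_space_def plus_bcontfun.rep_eq)
  show "c *\<^sub>R f \<in> growth_space t" if "f \<in> growth_space t" for c f
    using that osc_growth_scale[of "apply_bcontfun f" t c] subspace_scale[OF subspace_C01]
    by (auto simp: growth_space_def scaleR_bcontfun.rep_eq)
qed

text \<open>Because 1 < s, an exponent below 1 may be raised to 1. This presents N as an increasing
  union of subspaces, hence as a subspace.\<close>

lemma small_space_eq:
  assumes "1 < s"
  shows "small_space s = (\<Union>t\<in>{1..<s}. growth_space t)"
proof -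
  have "\<exists>t'\<in>{1..<s}. osc_growth t' f" if "t < s" "osc_growth t f" for t f
    using that assms osc_growth_mono[of t f "max 1 t"] by (intro bexI[of _ "max 1 t"]) auto
  then show ?thesis by (auto simp: small_space_def growth_space_def)
qed

lemma subspace_small_space:
  assumes "1 < s"
  shows "subspace (small_space s)"
proof (rule subspaceI)
  have sub: "subspace (growth_space t)" if "t \<in> {1..<s}" for t
    using that by (intro subspace_growth_space) simp
  show "0 \<in> small_space s"
    unfolding small_space_eq[OF assms] using subspace_0[OF sub[of 1]] assms by auto
  show "f + g \<in> small_space s" if fg: "f \<in> small_space s" "g \<in> small_space s" for f g
  proof -
    from fg obtain t u where tu: "t \<in> {1..<s}" "u \<in> {1..<s}" "f \<in> growth_space t" "g \<in> growth_space u"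
      unfolding small_space_eq[OF assms] by blast
    then have "f \<in> growth_space (max t u)" "g \<in> growth_space (max t u)"
      using osc_growth_mono by (auto simp: growth_space_def)
    moreover have "max t u \<in> {1..<s}" using tu by auto
    ultimately show ?thesis unfolding small_space_eq[OF assms] using subspace_add[OF sub] by blast
  qed
  show "c *\<^sub>R f \<in> small_space s" if "f \<in> small_space s" for c f
    using that unfolding small_space_eq[OF assms] using subspace_scale[OF sub] by blast
qed

lemma upper_box_dim_graph01_le_iff:
  assumes "f \<in> C01" "1 \<le> t"
  shows "upper_box_dim (graph01 f) \<le> ereal t \<longleftrightarrow> osc_growth t (apply_bcontfun f)"
proof -
  have "graph01 f = (\<lambda>x. (x, apply_bcontfun f x)) ` {0..1}" by (auto simp: graph01_def)
  moreover have "apply_bcontfun f x = apply_bcontfun f (clip 0 1 x)" for x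
    using assms(1) unfolding C01_def by blast
  ultimately show ?thesis using upper_box_dim_graph_le_iff[of "apply_bcontfun f" t] assms(2) by simp
qed

lemma upper_box_set_eq:
  assumes "1 < s"
  shows "upper_box_set s = growth_space s - small_space s"
proof -
  have "upper_box_dim (graph01 f) = ereal s \<longleftrightarrow>
      osc_growth s (apply_bcontfun f) \<and> \<not> (\<exists>t<s. osc_growth t (apply_bcontfun f))"
    if f: "f \<in> C01" for f
  proof -
    have "upper_box_dim (graph01 f) < ereal s \<longleftrightarrow> (\<exists>t<s. osc_growth t (apply_bcontfun f))"
    proof
      assume "upper_box_dim (graph01 f) < ereal s"
      then obtain r where "upper_box_dim (graph01 f) < ereal r" "ereal r < ereal s"
        using ereal_dense2 by blast
      \<comment> \<open>The maximum with 1 moves the exponent into the range where dimension and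
        growth are equivalent, and it stays below s.\<close>
      then have "upper_box_dim (graph01 f) \<le> ereal (max 1 r)" "max 1 r < s"
        using assms by (auto intro: order.trans less_imp_le)
      then show "\<exists>t<s. osc_growth t (apply_bcontfun f)"
        using upper_box_dim_graph01_le_iff[OF f, of "max 1 r"] by (intro exI[of _ "max 1 r"]) auto
    next
      assume "\<exists>t<s. osc_growth t (apply_bcontfun f)"
      then obtain t where "t < s" "osc_growth t (apply_bcontfun f)" by blast
      then have "osc_growth (max 1 t) (apply_bcontfun f)" "ereal (max 1 t) < ereal s"
        using assms osc_growth_mono[of t _ "max 1 t"] by auto
      then show "upper_box_dim (graph01 f) < ereal s"
        using upper_box_dim_graph01_le_iff[OF f, of "max 1 t"] by (simp add: le_less_trans)
    qed
    then show ?thesis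
      using upper_box_dim_graph01_le_iff[OF f, of s] assms by (auto simp: antisym_conv2)
  qed
  then show ?thesis by (auto simp: upper_box_set_def growth_space_def small_space_def)
qed

section \<open>Restriction to an interval and to its complement\<close>

definition restr :: "real \<Rightarrow> real \<Rightarrow> (real \<Rightarrow>\<^sub>C real) \<Rightarrow> (real \<Rightarrow>\<^sub>C real)" where
  "restr a b f = Bcontfun (\<lambda>x. apply_bcontfun f (clip a b x))"

lemma restr_apply: "apply_bcontfun (restr a b f) x = apply_bcontfun f (clip a b x)"
proof -
  have "continuous_on UNIV (\<lambda>x. apply_bcontfun f (clip a b x))"
    by (rule continuous_on_compose2[of UNIV]) (auto intro!: continuous_intros)
  from fun_cong[OF apply_bcontfun_Bcontfun[OF this norm_bounded]] show ?thesis
    unfolding restr_def .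
qed

lemma linear_restr: "linear (restr a b)"
  by (rule linearI) (auto intro!: bcontfun_eqI simp: restr_apply)

lemma restr_small_space:
  assumes "f \<in> small_space s" "0 \<le> a" "a \<le> b" "b \<le> 1"
  shows "restr a b f \<in> small_space s"
proof -
  obtain t where t: "t < s" "osc_growth t (apply_bcontfun f)" using assms(1) by (auto simp: small_space_def)
  have "clip a b (clip 0 1 x) = clip a b x" for x using assms by (auto simp: max_def min_def)
  then have "restr a b f \<in> C01" by (simp add: C01_def restr_apply)
  moreover have "osc_growth t (apply_bcontfun (restr a b f))"
    using osc_growth_clamp[OF _ t(2) assms(3)] by (simp add: restr_apply[abs_def])
  ultimately show ?thesis using t(1) by (auto simp: small_space_def)
qed

lemma const_small_space:
  assumes "1 < s"
  shows "const_bcontfun c \<in> small_space s"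
proof -
  have "osc_growth 1 (apply_bcontfun (const_bcontfun c))"
    using osc_growth_affine[of 1 0 c] by (simp add: const_bcontfun.rep_eq)
  then show ?thesis using assms by (auto simp: small_space_def C01_def const_bcontfun.rep_eq)
qed

text \<open>Both pieces are continued as constants, so on [0, a] and on [b, 1] this is f up to an
  additive constant, and in between it is constant. It is linear in f and ignores f inside (a,
  b).\<close>

definition outer :: "real \<Rightarrow> real \<Rightarrow> (real \<Rightarrow>\<^sub>C real) \<Rightarrow> (real \<Rightarrow>\<^sub>C real)" where
  "outer a b f = restr 0 a f + restr b 1 f"

lemma outer_decomp:
  assumes "f \<in> C01" "0 \<le> a" "a \<le> b" "b \<le> 1"
  shows "f = outer a b f + restr a b f - const_bcontfun (apply_bcontfun f a) - const_bcontfun (apply_bcontfun f b)"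
proof (rule bcontfun_eqI)
  fix x
  let ?f = "apply_bcontfun f"
  have "?f x = ?f (clip 0 1 x)" using assms(1) unfolding C01_def by blast
  also have "\<dots> = ?f (clip 0 a x) + ?f (clip a b x) + ?f (clip b 1 x) - ?f a - ?f b"
  proof -
    \<comment> \<open>In each region two of the three clips are frozen at a and b, one at each; the
      subtracted constants cancel exactly these values.\<close>
    consider "x \<le> a" | "a \<le> x" "x \<le> b" | "b \<le> x" by linarith
    then show ?thesis
    proof cases
      case 1
      then have "clip 0 1 x = clip 0 a x" "clip a b x = a" "clip b 1 x = b" using assms by (simp_all add: max_def min_def)
      then show ?thesis by simp
    next
      case 2
      then have "clip 0 1 x = clip a b x" "clip 0 a x = a" "clip b 1 x = b" using assms by (simp_all add: max_def min_def)
      then show ?thesis by simp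
    next
      case 3
      then have "clip 0 1 x = clip b 1 x" "clip 0 a x = a" "clip a b x = b" using assms by (simp_all add: max_def min_def)
      then show ?thesis by simp
    qed
  qed
  finally show "?f x = apply_bcontfun (outer a b f + restr a b f - const_bcontfun (?f a) - const_bcontfun (?f b)) x"
    by (simp add: outer_def restr_apply const_bcontfun.rep_eq)
qed

lemma restr_outer_left:
  assumes "0 \<le> c" "c \<le> d" "d \<le> a" "a \<le> b" "b \<le> 1"
  shows "restr c d (outer a b f) = restr c d f + const_bcontfun (apply_bcontfun f b)"
proof (rule bcontfun_eqI)
  fix x
  have "clip 0 a (clip c d x) = clip c d x" "clip b 1 (clip c d x) = b"
    using assms by (auto simp: max_def min_def)
  then show "apply_bcontfun (restr c d (outer a b f)) x
    = apply_bcontfun (restr c d f + const_bcontfun (apply_bcontfun f b)) x"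
    by (simp add: outer_def restr_apply const_bcontfun.rep_eq)
qed

lemma restr_outer_right:
  assumes "0 \<le> a" "a \<le> b" "b \<le> c" "c \<le> d" "d \<le> 1"
  shows "restr c d (outer a b f) = restr c d f + const_bcontfun (apply_bcontfun f a)"
proof (rule bcontfun_eqI)
  fix x
  have "clip 0 a (clip c d x) = a" "clip b 1 (clip c d x) = clip c d x"
    using assms by (auto simp: max_def min_def)
  then show "apply_bcontfun (restr c d (outer a b f)) x
    = apply_bcontfun (restr c d f + const_bcontfun (apply_bcontfun f a)) x"
    by (simp add: outer_def restr_apply const_bcontfun.rep_eq)
qed

lemma subspace_vimage_linear: "linear f \<Longrightarrow> subspace S \<Longrightarrow> subspace {x. f x \<in> S}"
  using linear_subspace_vimage[of f S] by (simp add: vimage_def)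

text \<open>Elements of W that become small outside the q-th dyadic interval, one for each q, would be
  linearly independent, because each of them is small on all intervals but its own.\<close>

lemma exists_free_dyadic_interval:
  assumes s: "1 < s" and B: "finite B" and W: "span B \<subseteq> C01" "span B \<inter> small_space s \<subseteq> {0}"
  obtains q where "1 \<le> q" "\<And>w. w \<in> span B \<Longrightarrow> outer (1 / 2 ^ q) (2 / 2 ^ q) w \<in> small_space s \<Longrightarrow> w = 0"
proof (rule ccontr)
  note free = that
  let ?N = "small_space s"
  let ?P = "\<lambda>q. restr (1 / 2 ^ q) (2 / 2 ^ q)" and ?O = "\<lambda>q. outer (1 / 2 ^ q) (2 / 2 ^ q)"
  note N = subspace_small_space[OF s]
  assume not_thesis: "\<not> thesis"
  have "\<exists>w. w \<in> span B \<and> w \<noteq> 0 \<and> ?O q w \<in> ?N" if "1 \<le> q" for q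
    using free[OF that] not_thesis by blast
  then obtain w where w: "\<And>q. 1 \<le> q \<Longrightarrow> w q \<in> span B" "\<And>q. 1 \<le> q \<Longrightarrow> w q \<noteq> 0"
    "\<And>q. 1 \<le> q \<Longrightarrow> ?O q (w q) \<in> ?N" by metis
  have ends: "0 \<le> 1 / (2 ^ q :: real)" "1 / 2 ^ q \<le> (2 / 2 ^ q :: real)" for q :: nat
    by (simp_all add: divide_right_mono)
  have le1: "2 / 2 ^ q \<le> (1 :: real)" if "1 \<le> q" for q
    using that power_increasing[of 1 q "2::real"] by simp
  have nested: "2 / 2 ^ r \<le> (1 / 2 ^ q :: real)" if "q < r" for q r
    using that power_increasing[of "Suc q" r "2::real"] by (simp add: field_simps)
  \<comment> \<open>If the inner part were small as well, then w q, a sum of small parts and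
    constants, would lie in N and hence be 0.\<close>
  have own: "?P q (w q) \<notin> ?N" if q: "1 \<le> q" for q
  proof
    assume P: "?P q (w q) \<in> ?N"
    have "w q \<in> C01" using w(1) q W(1) by blast
    from outer_decomp[OF this ends le1[OF q]] have "w q \<in> ?N"
      using subspace_diff[OF N subspace_diff[OF N subspace_add[OF N w(3)[OF q] P]]]
        const_small_space[OF s] by metis
    then show False using w(1,2) q W(2) by blast
  qed
  \<comment> \<open>The r-th interval lies outside the q-th, where w q differs from its small outer
    part only by a constant.\<close>
  have other: "?P r (w q) \<in> ?N" if "1 \<le> q" "1 \<le> r" "q \<noteq> r" for q r
  proof -
    have PO: "?P r (?O q (w q)) \<in> ?N"
      using w(3)[OF \<open>1 \<le> q\<close>] ends le1[OF \<open>1 \<le> r\<close>] by (rule restr_small_space)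
    have "\<exists>c. ?P r (?O q (w q)) = ?P r (w q) + const_bcontfun c"
    proof (cases "q < r")
      case True
      then show ?thesis using restr_outer_left[OF ends nested ends(2) le1[OF \<open>1 \<le> q\<close>]] by blast
    next
      case False
      then have "r < q" using that by simp
      then show ?thesis using restr_outer_right[OF ends nested ends(2) le1[OF \<open>1 \<le> r\<close>]] by blast
    qed
    then obtain c where "?P r (w q) = ?P r (?O q (w q)) - const_bcontfun c" by auto
    with subspace_diff[OF N PO const_small_space[OF s]] show ?thesis by metis
  qed
  \<comment> \<open>The functions that are small on the q-th interval form a subspace; it contains
    every other w r but not w q.\<close>
  have notin: "w q \<notin> span (w ` ({1..} - {q}))" if "1 \<le> q" for q
  proof
    assume "w q \<in> span (w ` ({1..} - {q}))"
    moreover have "span (w ` ({1..} - {q})) \<subseteq> {x. ?P q x \<in> ?N}"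
      using other that by (intro span_minimal subspace_vimage_linear linear_restr N) auto
    ultimately show False using own[OF that] by blast
  qed
  have "inj_on w {1..}"
  proof (rule inj_onI)
    fix q r :: nat assume qr: "q \<in> {1..}" "r \<in> {1..}" "w q = w r"
    show "q = r"
    proof (rule ccontr)
      assume "q \<noteq> r"
      then have "w q \<in> w ` ({1..} - {q})" using qr by blast
      from span_base[OF this] notin[of q] qr(1) show False by simp
    qed
  qed
  then have "infinite (w ` {1..})" using finite_imageD infinite_Ici by blast
  moreover have "independent (w ` {1..})"
    unfolding dependent_def
  proof
    assume "\<exists>a\<in>w ` {1..}. a \<in> span (w ` {1..} - {a})"
    then obtain q where q: "1 \<le> q" "w q \<in> span (w ` {1..} - {w q})" by auto
    have "w ` {1..} - {w q} \<subseteq> w ` ({1..} - {q})" by blast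
    with q notin[of q] span_mono show False by blast
  qed
  ultimately show False
    using independent_span_bound[OF B, of "w ` {1..}"] w(1) by auto
qed

section \<open>Closedness and size of the enlarged space\<close>

lemma closed_subspace_plus_line:
  fixes a :: "'a::real_normed_vector"
  assumes U: "subspace U" "closed U"
  shows "closed {x. \<exists>k. x - k *\<^sub>R a \<in> U}"
proof (cases "a \<in> U")
  case True
  then have "x - k *\<^sub>R a \<in> U \<longleftrightarrow> x \<in> U" for x k
    using U(1) by (metis add_diff_cancel_right' diff_add_cancel subspace_add subspace_diff subspace_scale)
  then show ?thesis using U(2) by simp
next
  case False
  define d where "d = infdist a U"
  have "U \<noteq> {}" using subspace_0[OF U(1)] by blast
  then have "0 < d" unfolding d_def using False U(2) infdist_pos_not_in_closed by blast
  show ?thesis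
    unfolding closed_sequential_limits
  proof (intro allI impI, elim conjE)
    fix x l assume x: "\<forall>n. x n \<in> {x. \<exists>k. x - k *\<^sub>R a \<in> U}" and lim: "x \<longlonglongrightarrow> l"
    then obtain k where k: "\<And>n. x n - k n *\<^sub>R a \<in> U" by auto metis
    \<comment> \<open>The distance d from a to U controls the coefficient of a, so the coefficients
      of a convergent sequence are Cauchy and the U-components converge too.\<close>
    have bound: "d * \<bar>k m - k n\<bar> \<le> norm (x m - x n)" for m n
    proof (cases "k m = k n")
      case False
      define c where "c = k m - k n"
      have "c \<noteq> 0" using False by (simp add: c_def)
      have "(x m - k m *\<^sub>R a) - (x n - k n *\<^sub>R a) \<in> U" by (intro subspace_diff[OF U(1)] k)
      then have "(- (1 / c)) *\<^sub>R ((x m - k m *\<^sub>R a) - (x n - k n *\<^sub>R a)) \<in> U" by (rule subspace_scale[OF U(1)])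
      also have "(x m - k m *\<^sub>R a) - (x n - k n *\<^sub>R a) = (x m - x n) - c *\<^sub>R a"
        by (simp add: c_def algebra_simps)
      also have "(- (1 / c)) *\<^sub>R \<dots> = a - (1 / c) *\<^sub>R (x m - x n)"
        using \<open>c \<noteq> 0\<close> by (simp add: algebra_simps)
      finally have "d \<le> dist a (a - (1 / c) *\<^sub>R (x m - x n))" unfolding d_def by (rule infdist_le)
      also have "\<dots> = norm (x m - x n) / \<bar>c\<bar>" by (simp add: dist_norm)
      finally show ?thesis using \<open>c \<noteq> 0\<close> by (simp add: c_def field_simps)
    qed simp
    have "Cauchy k"
    proof (rule metric_CauchyI)
      fix e :: real assume "0 < e"
      then have "0 < d * e" using \<open>0 < d\<close> by simp
      with LIMSEQ_imp_Cauchy[OF lim] obtain M where "\<forall>m\<ge>M. \<forall>n\<ge>M. dist (x m) (x n) < d * e"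
        unfolding Cauchy_def by blast
      then have "\<forall>m\<ge>M. \<forall>n\<ge>M. d * dist (k m) (k n) < d * e"
        using bound unfolding dist_norm real_norm_def by (meson le_less_trans)
      then show "\<exists>M. \<forall>m\<ge>M. \<forall>n\<ge>M. dist (k m) (k n) < e" using \<open>0 < d\<close> by auto
    qed
    then obtain t where "k \<longlonglongrightarrow> t" using Cauchy_convergent convergent_def by blast
    then have "(\<lambda>n. x n - k n *\<^sub>R a) \<longlonglongrightarrow> l - t *\<^sub>R a" by (intro tendsto_intros lim)
    with k have "l - t *\<^sub>R a \<in> U" by (rule closed_sequentially[OF U(2)])
    then show "l \<in> {x. \<exists>k. x - k *\<^sub>R a \<in> U}" by blast
  qed
qed

lemma closed_span_finite_Un:
  fixes V :: "'a::real_normed_vector set"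
  assumes "finite B" "subspace V" "closed V"
  shows "closed (span (B \<union> V))"
  using assms(1)
proof induction
  case empty
  have "span V = V" using assms(2) by (simp only: span_eq_iff)
  then show ?case using assms(3) by (simp only: sup_bot_left)
next
  case (insert a B)
  have "span (insert a B \<union> V) = {x. \<exists>k. x - k *\<^sub>R a \<in> span (B \<union> V)}"
    by (auto simp: span_breakdown_eq)
  then show ?case using closed_subspace_plus_line[OF subspace_span insert.IH] by simp
qed

text \<open>A continuous function is determined by the rational points strictly above its graph,
  that is, by a set of natural numbers. This bounds the size of every basis.\<close>

lemma bcontfun_lepoll_real: "(UNIV :: (real \<Rightarrow>\<^sub>C real) set) \<lesssim> (UNIV :: real set)"
proof -
  define code where "code f = to_nat ` {p :: rat \<times> rat. apply_bcontfun f (of_rat (fst p)) < of_rat (snd p)}"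
    for f :: "real \<Rightarrow>\<^sub>C real"
  have le: "apply_bcontfun g x \<le> apply_bcontfun f x" if "code f = code g" for f g x
  proof (rule ccontr)
    assume "\<not> ?thesis"
    then have "x \<in> {x. apply_bcontfun f x < apply_bcontfun g x}" by simp
    moreover have "open {x. apply_bcontfun f x < apply_bcontfun g x}" by (intro open_Collect_less) auto
    ultimately obtain e where e: "0 < e" "ball x e \<subseteq> {x. apply_bcontfun f x < apply_bcontfun g x}"
      by (meson open_contains_ball)
    obtain q where q: "x < of_rat q" "of_rat q < x + e" using of_rat_dense[of x "x + e"] e by auto
    then have "of_rat q \<in> ball x e" by (auto simp: dist_real_def)
    then have "apply_bcontfun f (of_rat q) < apply_bcontfun g (of_rat q)" using e(2) by blast
    then obtain r where r: "apply_bcontfun f (of_rat q) < of_rat r" "of_rat r < apply_bcontfun g (of_rat q)"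
      using of_rat_dense by blast
    then have "to_nat (q, r) \<in> code f" unfolding code_def by (intro imageI) simp
    moreover have "to_nat (q, r) \<notin> code g" unfolding code_def using r by auto
    ultimately show False using that by simp
  qed
  have "inj code"
  proof (rule injI)
    fix f g assume "code f = code g"
    then show "f = g" using le[of f g] le[of g f] by (intro bcontfun_eqI antisym) auto
  qed
  then have "(UNIV :: (real \<Rightarrow>\<^sub>C real) set) \<lesssim> (UNIV :: nat set set)" unfolding lepoll_def by blast
  then show ?thesis using nat_sets_eqpoll_reals lepoll_trans2 by blast
qed

text \<open>If w + v is small, so is its outer part, which equals that of w because V vanishes
  there; the choice of q gives w = 0, and then v = 0. The independent set E is returned as well, so
  that the case of empty B also settles lineability.\<close>

lemma finite_dim_in_closed_continuum_dim:
  assumes s: "1 < s" "s \<le> 2" and B: "finite B" and W: "span B \<subseteq> upper_box_set s \<union> {0}"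
  obtains W' E where "subspace W'" "closed W'" "has_dim W' (UNIV :: real set)" "span B \<subseteq> W'"
    "W' \<subseteq> upper_box_set s \<union> {0}" "E \<subseteq> W'" "independent E" "E \<approx> (UNIV :: real set)"
proof -
  let ?N = "small_space s" and ?L = "growth_space s"
  note N = subspace_small_space[OF s(1)]
  have L: "subspace ?L" using s by (intro subspace_growth_space) simp
  have eq: "upper_box_set s = ?L - ?N" using upper_box_set_eq[OF s(1)] .
  have WL: "span B \<subseteq> ?L" using W eq subspace_0[OF L] by blast
  have WN: "span B \<inter> ?N \<subseteq> {0}" using W eq by blast
  have "span B \<subseteq> C01" using WL by (auto simp: growth_space_def)
  from exists_free_dyadic_interval[OF s(1) B this WN] obtain q where q: "1 \<le> q"
    "\<And>w. w \<in> span B \<Longrightarrow> outer (1 / 2 ^ q) (2 / 2 ^ q) w \<in> ?N \<Longrightarrow> w = 0" by blast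
  define V where "V = block_space (2 - s) q"
  have V: "subspace V" "closed V" unfolding V_def by (rule subspace_block_space closed_block_space)+
  have VL: "V \<subseteq> ?L" using block_space_subset_C01[OF q(1)] osc_growth_block_space[OF _ s]
    unfolding V_def growth_space_def by blast
  have VN: "v = 0" if "v \<in> V" "v \<in> ?N" for v
    using that not_osc_growth_block_space[of v s q] s q(1) unfolding V_def small_space_def by blast
  have outer_V: "outer (1 / 2 ^ q) (2 / 2 ^ q) v = 0" if "v \<in> V" for v
  proof (rule bcontfun_eqI)
    fix x :: real
    have "clip 0 (1 / 2 ^ q) x \<le> 1 / 2 ^ q" "2 / 2 ^ q \<le> clip (2 / 2 ^ q) 1 x" by simp_all
    then show "apply_bcontfun (outer (1 / 2 ^ q) (2 / 2 ^ q) v) x = apply_bcontfun 0 x"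
      using that unfolding V_def by (simp add: outer_def restr_apply block_space_outside)
  qed
  define W' where "W' = span (B \<union> V)"
  have W'_eq: "W' = {w + v |w v. w \<in> span B \<and> v \<in> V}"
    unfolding W'_def span_Un using V(1) by (simp add: span_eq_iff[THEN iffD2])
  have sub: "W' \<subseteq> upper_box_set s \<union> {0}"
  proof
    fix x assume "x \<in> W'"
    then obtain w v where x: "x = w + v" "w \<in> span B" "v \<in> V" using W'_eq by blast
    then have "x \<in> ?L" using WL VL subspace_add[OF L] by blast
    moreover have "x = 0" if "x \<in> ?N"
    proof -
      have q1: "2 / 2 ^ q \<le> (1 :: real)" using q(1) power_increasing[of 1 q "2::real"] by simp
      have "1 / 2 ^ q \<le> (2 / 2 ^ q :: real)" by (simp add: divide_right_mono)
      then have "outer (1 / 2 ^ q) (2 / 2 ^ q) x \<in> ?N"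
        unfolding outer_def using q1 that by (intro subspace_add N restr_small_space) auto
      also have "outer (1 / 2 ^ q) (2 / 2 ^ q) x = outer (1 / 2 ^ q) (2 / 2 ^ q) w + outer (1 / 2 ^ q) (2 / 2 ^ q) v"
        unfolding x(1) outer_def by (simp add: linear_add[OF linear_restr])
      finally have "w = 0" using q(2) x outer_V by simp
      then show "x = 0" using x VN that by simp
    qed
    ultimately show "x \<in> upper_box_set s \<union> {0}" unfolding eq by blast
  qed
  obtain E where E: "E \<subseteq> V" "independent E" "E \<approx> (UNIV :: real set)"
    using block_space_independent_continuum[of "2 - s" q] s unfolding V_def by auto
  have VW': "V \<subseteq> W'" unfolding W'_def by (meson Un_upper2 order.trans span_superset)
  \<comment> \<open>Extending E to a basis gives the lower bound on its size; the cardinality of the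
    whole function space gives the upper bound.\<close>
  obtain B' where B': "E \<subseteq> B'" "B' \<subseteq> W'" "independent B'" "W' \<subseteq> span B'"
    using maximal_independent_subset_extend[of E W'] E VW' by blast
  have "span B' = W'"
    using B'(2,4) span_minimal[of B' W'] by (auto simp: W'_def)
  moreover have "B' \<approx> (UNIV :: real set)"
  proof (rule lepoll_antisym)
    show "B' \<lesssim> (UNIV :: real set)"
      using bcontfun_lepoll_real subset_imp_lepoll[OF subset_UNIV] lepoll_trans by blast
    show "(UNIV :: real set) \<lesssim> B'"
      using E(3) subset_imp_lepoll[OF B'(1)] eqpoll_sym lepoll_trans1 by blast
  qed
  ultimately have "has_dim W' (UNIV :: real set)" unfolding has_dim_def using B'(3) by blast
  moreover have "span B \<subseteq> W'" unfolding W'_def by (intro span_mono) simp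
  moreover have "closed W'" unfolding W'_def by (intro closed_span_finite_Un B V)
  moreover have "subspace W'" unfolding W'_def by simp
  ultimately show ?thesis using that sub E VW' by blast
qed

section \<open>The two implications\<close>

lemma spaceable_if_finite:
  assumes s: "1 < s" "s \<le> 2" and "finite X"
  shows "spaceable X (UNIV :: real set) (upper_box_set s)"
  unfolding spaceable_def
proof (intro conjI allI impI)
  show "X \<prec> (UNIV :: real set)"
    using \<open>finite X\<close> by (intro finite_lesspoll_infinite) (auto simp: infinite_UNIV_char_0)
  show "lineable X (upper_box_set s)"
  proof -
    \<comment> \<open>Starting from the zero space produces a continuum of independent functions
      inside the set; any card X of them span a witness.\<close>
    have "span {} \<subseteq> upper_box_set s \<union> {0}" by simp
    from finite_dim_in_closed_continuum_dim[OF s finite.emptyI this]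
    obtain W' E where W': "subspace W'" "W' \<subseteq> upper_box_set s \<union> {0}" "E \<subseteq> W'"
      "independent E" "E \<approx> (UNIV :: real set)" by metis
    have "infinite E" using W'(5) eqpoll_finite_iff infinite_UNIV_char_0 by blast
    then obtain F where F: "F \<subseteq> E" "finite F" "card F = card X"
      using infinite_arbitrarily_large by metis
    have "span F \<subseteq> W'" using F(1) W'(1,3) by (intro span_minimal) auto
    moreover have "F \<approx> X" using F \<open>finite X\<close> by (simp add: eqpoll_iff_card)
    moreover have "independent F" using F(1) W'(4) independent_mono by blast
    ultimately show ?thesis
      unfolding lineable_def has_dim_def using W'(2) by (intro exI[of _ "span F"]) auto
  qed
next
  fix W assume "subspace W \<and> W \<subseteq> upper_box_set s \<union> {0} \<and> has_dim W X"
  then obtain B where B: "W \<subseteq> upper_box_set s \<union> {0}" "span B = W" "B \<approx> X" by (auto simp: has_dim_def)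
  have "finite B" using B(3) \<open>finite X\<close> eqpoll_finite_iff by blast
  from finite_dim_in_closed_continuum_dim[OF s this] B(1,2)
  show "\<exists>W'. subspace W' \<and> closed W' \<and> has_dim W' (UNIV :: real set) \<and> W \<subseteq> W' \<and> W' \<subseteq> upper_box_set s \<union> {0}"
    by metis
qed

text \<open>Perturbing an infinite-dimensional space by multiples of h along an unbounded functional
  keeps it inside the set, but puts h into its closure.\<close>

lemma finite_if_spaceable:
  assumes s: "1 < s" and sp: "spaceable X Y (upper_box_set s)"
  shows "finite X"
proof (rule ccontr)
  assume "infinite X"
  let ?N = "small_space s" and ?L = "growth_space s"
  note N = subspace_small_space[OF s]
  have L: "subspace ?L" using s by (intro subspace_growth_space) simp
  have eq: "upper_box_set s = ?L - ?N" using upper_box_set_eq[OF s] .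
  have "\<bar>clip 0 1 x\<bar> \<le> 1" for x :: real by simp
  then have h: "apply_bcontfun (Bcontfun (clip 0 1)) = (clip 0 1 :: real \<Rightarrow> real)"
    by (intro apply_bcontfun_Bcontfun[where B = 1] continuous_intros) auto
  define h where "h = (Bcontfun (clip 0 1) :: real \<Rightarrow>\<^sub>C real)"
  note h = h[folded h_def]
  have "h \<in> C01" by (simp add: C01_def h)
  moreover have "osc_growth 1 (apply_bcontfun h)" using osc_growth_affine[of 1 1 0] by (simp add: h)
  ultimately have hN: "h \<in> ?N" and hL: "h \<in> ?L"
    using s osc_growth_mono[of 1 _ s] by (auto simp: small_space_def growth_space_def)
  have "apply_bcontfun h 1 \<noteq> 0" unfolding h by simp
  then have "h \<noteq> 0" by auto
  from sp obtain M B where M: "M \<subseteq> upper_box_set s \<union> {0}" "independent B" "span B = M" "B \<approx> X"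
    by (auto simp: spaceable_def lineable_def has_dim_def)
  have "infinite B" using M(4) \<open>infinite X\<close> eqpoll_finite_iff by blast
  then obtain b :: "nat \<Rightarrow> real \<Rightarrow>\<^sub>C real" where b: "inj b" "range b \<subseteq> B"
    using infinite_countable_subset by blast
  have b0: "b n \<noteq> 0" for n
  proof
    assume "b n = 0"
    with range_subsetD[OF b(2), of n] have "0 \<in> B" by simp
    from dependent_zero[OF this] M(2) show False by simp
  qed
  \<comment> \<open>These values make b n / l (b n) a vector of norm 1 / (n + 1). A countable part
    of the basis suffices; the functional is 0 on the rest.\<close>
  define c where "c x = (if x \<in> range b then real (Suc (the_inv b x)) * norm x else 0)" for x
  obtain l :: "(real \<Rightarrow>\<^sub>C real) \<Rightarrow> real" where l: "linear l" "\<And>x. x \<in> B \<Longrightarrow> l x = c x"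
    using linear_independent_extend[OF M(2), of c] by blast
  have lb: "l (b n) = real (Suc n) * norm (b n)" for n
    using l(2)[of "b n"] b by (auto simp: c_def the_inv_f_f)
  define G where "G x = x + l x *\<^sub>R h" for x
  have G: "linear G" unfolding G_def
    by (intro linearI) (simp_all add: linear_add[OF l(1)] linear_scale[OF l(1)] algebra_simps)
  \<comment> \<open>G changes x only by an element of N, so it preserves membership in L - N. As 0
    lies in N, it also follows that G is injective on M.\<close>
  have GA: "G x \<in> upper_box_set s" if "x \<in> M" "x \<noteq> 0" for x
  proof -
    have x: "x \<in> ?L" "x \<notin> ?N" using that M(1) eq by auto
    have lh: "l x *\<^sub>R h \<in> ?N" "l x *\<^sub>R h \<in> ?L" using hN hL subspace_scale N L by blast+
    have "G x \<in> ?L" unfolding G_def using x lh subspace_add L by blast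
    moreover have "G x \<notin> ?N"
      using subspace_diff[OF N _ lh(1), of "G x"] x(2) by (auto simp: G_def)
    ultimately show ?thesis unfolding eq by blast
  qed
  have G0: "x = 0" if "x \<in> M" "G x = 0" for x
    using GA[OF that(1)] that(2) subspace_0[OF N] unfolding eq by fastforce
  have inj: "inj_on G (span B)"
  proof (rule inj_onI)
    fix x y assume xy: "x \<in> span B" "y \<in> span B" "G x = G y"
    then have "G (x - y) = 0" by (simp add: linear_diff[OF G])
    then show "x = y" using G0[of "x - y"] xy M(3) span_diff by auto
  qed
  define W where "W = span (G ` B)"
  have W: "W = G ` M" unfolding W_def M(3)[symmetric] by (rule span_linear_image[OF G])
  have "independent (G ` B)" using linear_independent_injective_image[OF G M(2) inj] .
  moreover have "G ` B \<approx> X"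
    using inj_on_image_eqpoll_self[OF inj_on_subset[OF inj span_superset]] M(4) eqpoll_trans by blast
  ultimately have "has_dim W X" unfolding has_dim_def W_def by blast
  moreover have "W \<subseteq> upper_box_set s \<union> {0}"
    unfolding W using GA linear_0[OF G] by force
  moreover have "subspace W" unfolding W_def by simp
  ultimately have WX: "subspace W \<and> W \<subseteq> upper_box_set s \<union> {0} \<and> has_dim W X" by (intro conjI)
  have "\<forall>W. subspace W \<and> W \<subseteq> upper_box_set s \<union> {0} \<and> has_dim W X \<longrightarrow>
      (\<exists>W'. subspace W' \<and> closed W' \<and> has_dim W' Y \<and> W \<subseteq> W' \<and> W' \<subseteq> upper_box_set s \<union> {0})"
    using sp unfolding spaceable_def by (elim conjE)
  from this[THEN spec, THEN mp, OF WX] obtain W' where W': "subspace W'" "closed W'" "W \<subseteq> W'" "W' \<subseteq> upper_box_set s \<union> {0}"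
    by (elim exE conjE)
  \<comment> \<open>Dividing by l (b n) turns the perturbation into exactly h, while the original
    vector shrinks to 0.\<close>
  have lim: "(\<lambda>n. (1 / l (b n)) *\<^sub>R G (b n)) \<longlonglongrightarrow> 0 + h"
  proof -
    have ne: "l (b n) \<noteq> 0" for n using lb b0 by simp
    have "norm ((1 / l (b n)) *\<^sub>R b n) = 1 / real (Suc n)" for n
      using b0[of n] by (simp add: lb del: of_nat_Suc)
    then have "(\<lambda>n. norm ((1 / l (b n)) *\<^sub>R b n)) \<longlonglongrightarrow> 0"
      using LIMSEQ_Suc[OF lim_1_over_n] by simp
    then have "(\<lambda>n. (1 / l (b n)) *\<^sub>R b n) \<longlonglongrightarrow> 0" by (rule tendsto_norm_zero_cancel)
    then have "(\<lambda>n. (1 / l (b n)) *\<^sub>R b n + h) \<longlonglongrightarrow> 0 + h" by (intro tendsto_intros)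
    moreover have "(1 / l (b n)) *\<^sub>R G (b n) = (1 / l (b n)) *\<^sub>R b n + h" for n
      using ne[of n] by (simp add: G_def scaleR_add_right)
    ultimately show ?thesis by simp
  qed
  have mem: "(1 / l (b n)) *\<^sub>R G (b n) \<in> W'" for n
  proof -
    have "b n \<in> M" using b(2) M(3) span_base by blast
    then have "G (b n) \<in> W'" using W W'(3) by blast
    then show ?thesis by (rule subspace_scale[OF W'(1)])
  qed
  from mem lim have "0 + h \<in> W'" by (rule closed_sequentially[OF W'(2)])
  then show False using W'(4) \<open>h \<noteq> 0\<close> hN eq by auto
qed

theorem theorem4p2:
  fixes s :: real and X :: "'x set"
  assumes "1 < s" "s \<le> 2"
  shows "spaceable X (UNIV :: real set) (upper_box_set s) \<longleftrightarrow> finite X"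
  using spaceable_if_finite[OF assms] finite_if_spaceable[OF assms(1)] by blast

end
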